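(* Fix $\epsilon_0\in(0,1/2)$, $A>0$ and $\gamma\in(0,1/A)$, and let $t_n=t_n(\gamma)=\sqrt{\gamma\log n}$. Consider densities $f=f(\cdot;u_0,\sigma_0,\epsilon_n,H_n,n)\in\Lambda_n(\epsilon_0,A)$ satisfying, as $n\to\infty$, at least one of the following three conditions: (a) $\lim_{n\to\infty}\epsilon_n\, t_n(\gamma)=0$; (b) $P_{H_n}(u>u_0+\delta_n)=1$, where $\delta_n>0$ satisfies, for some constant $c_0>0$, $$\liminf_{n\to\infty}\Big\{\frac{\delta_n t_n}{\sqrt2\,\log(t_n)}\Big\}\ge c_0+1;$$ (c) under $H_n$ the pair $(\delta,\kappa)=(u-u_0,(\sigma^2-\sigma_0^2)/2)$ has a joint density, and for some constants $\alpha>0$ and $C>0$, for all $\delta$ in the range and all real $t$, $$|h_n^{FT}(t\mid\delta)|\le C(1+|t|)^{-\alpha},\qquad \Big|\frac{d}{dt}h_n^{FT}(t\mid\delta)\Big|\le C(1+|t|)^{-(\alpha+1)}.$$ Then the estimators $u_0(\varphi_n;t_n(\gamma))$ and $\sigma_0^2(\varphi_n;t_n(\gamma))$ are consistent for $u_0$ and $\sigma_0^2$ respectively, uniformly across all densities in $\Lambda_n(\epsilon_0,A)$ satisfying one or more of (a), (b), (c). Precisely: fix a sequence $a_n\to0$, a positive sequence $\delta_n$ satisfying the liminf condition in (b) for some $c_0>0$, and constants $\alpha,C>0$; let $\Lambda_n^*$ be the set of $f\in\Lambda_n(\epsilon_0,A)$ for which $\epsilon_n t_n\le a_n$, or $P_{H_n}(u>u_0+\delta_n)=1$,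 or the bounds in (c) hold with these $\alpha,C$. Then for every $\eta>0$, $$\lim_{n\to\infty}\ \sup_{f\in\Lambda_n^*}P_f\big(|u_0(\varphi_n;t_n(\gamma))-u_0|>\eta\big)=0,\qquad \lim_{n\to\infty}\ \sup_{f\in\Lambda_n^*}P_f\big(|\sigma_0^2(\varphi_n;t_n(\gamma))-\sigma_0^2|>\eta\big)=0.$$
   Context: $\phi$ is the $N(0,1)$ density, $i=\sqrt{-1}$, $\omega=-(1+i)/\sqrt2$ (so $\omega^2=i$). For each $n$, $X_1,\dots,X_n$ are i.i.d. with density $$f(x)=f(x;u_0,\sigma_0,\epsilon_n,H_n,n)=(1-\epsilon_n)\frac1{\sigma_0}\phi\Big(\frac{x-u_0}{\sigma_0}\Big)+\epsilon_n\int\frac1\sigma\phi\Big(\frac{x-u}{\sigma}\Big)dH_n(u,\sigma),$$ where $\sigma_0>0$ and $H_n$ is a probability distribution of $(u,\sigma)\in\mathbb{R}\times(0,\infty)$; $P_{H_n}$ is probability under $H_n$ and $P_f$ is probability when the $X_j$ are i.i.d. from $f$. $\Lambda_n(\epsilon_0,A)$ is the class of all such densities with $0<\epsilon_n\le\epsilon_0$, $u_0\ge -A$, $\sigma_0^2\le A$, $P_{H_n}(u>u_0)=1$ and $P_{H_n}(\sigma^2\le A)=1$ (suprema over the class range over all admissible parameters $(u_0,\sigma_0,\epsilon_n,H_n)$). The generalized empirical characteristic function is $\varphi_n(t)=\frac1n\sum_{j=1}^n\exp(\omega tX_j)$. For a differentiable complex-valued function $g$ of a real variable, and $t>0$ with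 $g(t)\ne0$, $$u_0(g;t)=-\frac{\sqrt2}{|g(t)|}\frac{d}{dt}|g(t)|,\qquad \sigma_0^2(g;t)=\frac{\sqrt2\,\mathrm{Re}\big(\omega\,\overline{g(t)}\,g'(t)\big)}{t\,|g(t)|^2}.$$ (On the event $\varphi_n(t)=0$ the estimators may be given arbitrary values.) In (c), $h_n(\kappa\mid\delta)$ is the conditional density of $\kappa$ given $\delta$ when $(u,\sigma)\sim H_n$, and $h_n^{FT}(t\mid\delta)=\int e^{it\kappa}h_n(\kappa\mid\delta)\,d\kappa$ is its Fourier transform. *)

theory Defs
  imports "HOL-Probability.Probability"
begin

definition omega :: complex where
  "omega = - (1 + \<i>) / complex_of_real (sqrt 2)"

lemma omega_squared: "omega\<^sup>2 = \<i>"
  by (simp add: omega_def complex_eq_iff power2_eq_square field_simps)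

text \<open>
  For \<open>\<sigma> > 0\<close>, \<^term>\<open>normal_density u \<sigma> x\<close> is
  \<open>(1/\<sigma>) \<phi>((x - u)/\<sigma>)\<close>. The mixture is taken in \<^typ>\<open>ennreal\<close>, because mass of \<open>H\<close>
  near \<open>\<sigma> = 0\<close> may make the integral infinite on a Lebesgue null set of \<open>x\<close>.
\<close>

definition mix_density ::
  "real \<Rightarrow> real \<Rightarrow> real \<Rightarrow> (real \<times> real) measure \<Rightarrow> real \<Rightarrow> ennreal" where
  "mix_density u0 \<sigma>0 \<epsilon> H x =
     ennreal ((1 - \<epsilon>) * normal_density u0 \<sigma>0 x)
     + ennreal \<epsilon> * (\<integral>\<^sup>+ (u, \<sigma>). ennreal (normal_density u \<sigma> x) \<partial>H)"

lemma prob_space_mix_density: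
  assumes s0: "0 < \<sigma>0" and e: "0 \<le> \<epsilon>" "\<epsilon> \<le> 1"
    and H: "prob_space H" and sH: "sets H = sets borel" and pos: "measure H {(u, \<sigma>). 0 < \<sigma>} = 1"
  shows "mix_density u0 \<sigma>0 \<epsilon> H \<in> borel_measurable lborel"
    and "prob_space (density lborel (mix_density u0 \<sigma>0 \<epsilon> H))"
proof -
  interpret H: prob_space H by (rule H)
  interpret P: pair_sigma_finite lborel H ..
  have sH': "sets H = sets (borel \<Otimes>\<^sub>M borel)" using sH by (simp only: borel_prod)
  note [measurable_cong] = sH'
  have m2 [measurable]: "(\<lambda>(x, u, \<sigma>). ennreal (normal_density u \<sigma> x)) \<in> borel_measurable (lborel \<Otimes>\<^sub>M H)"
    unfolding normal_density_def by measurable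
  have m1 [measurable]: "(\<lambda>x. \<integral>\<^sup>+ (u, \<sigma>). ennreal (normal_density u \<sigma> x) \<partial>H) \<in> borel_measurable lborel"
    by measurable
  show m: "mix_density u0 \<sigma>0 \<epsilon> H \<in> borel_measurable lborel"
    unfolding mix_density_def by measurable
  have ae: "AE z in H. 0 < snd z"
    using pos H.AE_prob_1[of "{(u, \<sigma>). 0 < \<sigma>}"] by (auto simp: case_prod_beta)
  have n1: "(\<integral>\<^sup>+ x. ennreal (normal_density u \<sigma> x) \<partial>lborel) = 1" if "0 < \<sigma>" for u \<sigma>
    using prob_space.emeasure_space_1[OF prob_space_normal_density[OF that, of u]]
    by (simp add: emeasure_density)
  have "(\<integral>\<^sup>+ x. (\<integral>\<^sup>+ (u, \<sigma>). ennreal (normal_density u \<sigma> x) \<partial>H) \<partial>lborel)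
      = (\<integral>\<^sup>+ z. (\<integral>\<^sup>+ x. ennreal (normal_density (fst z) (snd z) x) \<partial>lborel) \<partial>H)"
    using P.Fubini'[of "\<lambda>x z. ennreal (normal_density (fst z) (snd z) x)", symmetric] m2
    by (simp add: case_prod_beta')
  also have "\<dots> = (\<integral>\<^sup>+ z. 1 \<partial>H)"
    by (rule nn_integral_cong_AE) (use ae n1 in auto)
  finally have i: "(\<integral>\<^sup>+ x. (\<integral>\<^sup>+ (u, \<sigma>). ennreal (normal_density u \<sigma> x) \<partial>H) \<partial>lborel) = 1"
    by (simp add: H.emeasure_space_1)
  have "(\<integral>\<^sup>+ x. mix_density u0 \<sigma>0 \<epsilon> H x \<partial>lborel) = ennreal (1 - \<epsilon>) + ennreal \<epsilon>"
    unfolding mix_density_def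
    using e by (simp add: nn_integral_add nn_integral_cmult i n1[OF s0] ennreal_mult')
  also have "\<dots> = 1" using e by (simp flip: ennreal_plus)
  finally show "prob_space (density lborel (mix_density u0 \<sigma>0 \<epsilon> H))"
    by (intro prob_spaceI) (use m in \<open>simp add: emeasure_density\<close>)
qed

text \<open>The joint law of the sample \<open>X\<^sub>1, \<dots>, X\<^sub>n\<close>.\<close>

definition sample_measure ::
  "nat \<Rightarrow> real \<Rightarrow> real \<Rightarrow> real \<Rightarrow> (real \<times> real) measure \<Rightarrow> (nat \<Rightarrow> real) measure" where
  "sample_measure n u0 \<sigma>0 \<epsilon> H =
     (\<Pi>\<^sub>M j\<in>{1..n}. density lborel (mix_density u0 \<sigma>0 \<epsilon> H))"

text \<open>
  The class \<open>\<Lambda>\<^sub>n(\<epsilon>\<^sub>0, A)\<close>, given by its admissible parameters \<open>(u\<^sub>0, \<sigma>\<^sub>0, \<epsilon>, H)\<close>. The constraints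
  are the same for every \<open>n\<close>; the dependence of the parameters on \<open>n\<close> arises because the suprema
  are taken separately for each \<open>n\<close>.
\<close>

definition Lambda :: "real \<Rightarrow> real \<Rightarrow> (real \<times> real \<times> real \<times> (real \<times> real) measure) set" where
  "Lambda \<epsilon>0 A = {(u0, \<sigma>0, \<epsilon>, H).
     0 < \<sigma>0 \<and> \<sigma>0\<^sup>2 \<le> A \<and> - A \<le> u0 \<and> 0 < \<epsilon> \<and> \<epsilon> \<le> \<epsilon>0
     \<and> prob_space H \<and> sets H = sets borel
     \<and> measure H {(u, \<sigma>). 0 < \<sigma>} = 1
     \<and> measure H {(u, \<sigma>). u0 < u} = 1
     \<and> measure H {(u, \<sigma>). \<sigma>\<^sup>2 \<le> A} = 1}"

definition gecf :: "nat \<Rightarrow> (nat \<Rightarrow> real) \<Rightarrow> real \<Rightarrow> complex" where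
  "gecf n x t = (\<Sum>j=1..n. exp (omega * complex_of_real (t * x j))) / of_nat n"

definition u0_fun :: "(real \<Rightarrow> complex) \<Rightarrow> real \<Rightarrow> real" where
  "u0_fun g t = - (sqrt 2 / cmod (g t)) * deriv (\<lambda>s. cmod (g s)) t"

definition sigma0_sq_fun :: "(real \<Rightarrow> complex) \<Rightarrow> real \<Rightarrow> real" where
  "sigma0_sq_fun g t =
     sqrt 2 * Re (omega * cnj (g t) * vector_derivative g (at t)) / (t * (cmod (g t))\<^sup>2)"

text \<open>The argument \<open>d\<close> supplies the arbitrary value of an estimator on the event \<open>\<phi>\<^sub>n(t) = 0\<close>.\<close>

definition u0_est :: "((nat \<Rightarrow> real) \<Rightarrow> real) \<Rightarrow> nat \<Rightarrow> real \<Rightarrow> (nat \<Rightarrow> real) \<Rightarrow> real" where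
  "u0_est d n t x = (if gecf n x t = 0 then d x else u0_fun (gecf n x) t)"

definition sigma0_sq_est :: "((nat \<Rightarrow> real) \<Rightarrow> real) \<Rightarrow> nat \<Rightarrow> real \<Rightarrow> (nat \<Rightarrow> real) \<Rightarrow> real" where
  "sigma0_sq_est d n t x = (if gecf n x t = 0 then d x else sigma0_sq_fun (gecf n x) t)"

definition t_seq :: "real \<Rightarrow> nat \<Rightarrow> real" where
  "t_seq \<gamma> n = sqrt (\<gamma> * ln (real n))"

text \<open>
  Conditional density of the second coordinate given that the first is \<open>\<delta>\<close>, for a joint density
  \<open>p\<close> on the plane. It is meaningful where the marginal density of the first coordinate is
  positive and finite; as the Bochner integral of a non-integrable function is \<open>0\<close>, this is
  exactly where \<^term>\<open>marginal p \<delta> > 0\<close>.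
\<close>

definition marginal :: "(real \<times> real \<Rightarrow> real) \<Rightarrow> real \<Rightarrow> real" where
  "marginal p \<delta> = (LINT \<kappa>|lborel. p (\<delta>, \<kappa>))"

definition cond_density :: "(real \<times> real \<Rightarrow> real) \<Rightarrow> real \<Rightarrow> real \<Rightarrow> real" where
  "cond_density p \<delta> \<kappa> = p (\<delta>, \<kappa>) / marginal p \<delta>"

definition cond_FT :: "(real \<times> real \<Rightarrow> real) \<Rightarrow> real \<Rightarrow> real \<Rightarrow> complex" where
  "cond_FT p \<delta> t = (CLINT \<kappa>|lborel. iexp (t * \<kappa>) * complex_of_real (cond_density p \<delta> \<kappa>))"

text \<open>
  Joint densities are determined only up to null sets, so the bounds are required for some version
  of the density, at every \<open>\<delta>\<close> where its marginal density is positive.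
\<close>

definition FT_bounds ::
  "real \<Rightarrow> real \<Rightarrow> real \<Rightarrow> real \<Rightarrow> (real \<times> real) measure \<Rightarrow> bool" where
  "FT_bounds \<alpha> C u0 \<sigma>0 H \<longleftrightarrow>
     (\<exists>p. (\<forall>z. 0 \<le> p z)
        \<and> distributed H (lborel \<Otimes>\<^sub>M lborel) (\<lambda>(u, \<sigma>). (u - u0, (\<sigma>\<^sup>2 - \<sigma>0\<^sup>2) / 2))
            (\<lambda>z. ennreal (p z))
        \<and> (\<forall>\<delta>. marginal p \<delta> > 0 \<longrightarrow> (\<forall>t.
              cmod (cond_FT p \<delta> t) \<le> C * (1 + \<bar>t\<bar>) powr (- \<alpha>)
              \<and> cond_FT p \<delta> differentiable (at t)
              \<and> cmod (vector_derivative (cond_FT p \<delta>) (at t))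
                    \<le> C * (1 + \<bar>t\<bar>) powr (- (\<alpha> + 1)))))"

text \<open>The class \<open>\<Lambda>\<^sub>n\<^sup>*\<close>; \<open>t\<close>, \<open>a\<close> and \<open>d\<close> stand for \<open>t\<^sub>n\<close>, \<open>a\<^sub>n\<close> and \<open>\<delta>\<^sub>n\<close>.\<close>

definition Lambda_star ::
  "real \<Rightarrow> real \<Rightarrow> real \<Rightarrow> real \<Rightarrow> real \<Rightarrow> real \<Rightarrow> real
   \<Rightarrow> (real \<times> real \<times> real \<times> (real \<times> real) measure) set" where
  "Lambda_star \<epsilon>0 A t a d \<alpha> C = {(u0, \<sigma>0, \<epsilon>, H).
     (u0, \<sigma>0, \<epsilon>, H) \<in> Lambda \<epsilon>0 A
     \<and> (\<epsilon> * t \<le> a \<or> measure H {(u, \<sigma>). u0 + d < u} = 1 \<or> FT_bounds \<alpha> C u0 \<sigma>0 H)}"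

end

theory Submission imports Defs "HOL-Real_Asymp.Real_Asymp" begin

text \<open>
  For a normal variable with mean \<open>u\<close> and variance \<open>\<sigma>\<^sup>2\<close>, the expectation of \<open>exp (omega * t * X)\<close> is
  \<open>exp (omega * t * u + \<i> * t\<^sup>2 * \<sigma>\<^sup>2 / 2)\<close>: the direction \<open>omega\<close> is chosen so that the modulus depends on the
  mean only and the variance appears as a phase. The logarithmic derivative in \<open>t\<close> is
  \<open>omega * u + \<i> * t * \<sigma>\<^sup>2\<close>, and the two functionals extract \<open>u\<close> and \<open>\<sigma>\<^sup>2\<close> from it.

  For the mixture, let \<open>W\<close> be the empirical average of \<open>exp (omega * t * (X - u0))\<close>, and let \<open>Z\<close> be the derivative
  of this average minus \<open>\<i> * t * \<sigma>0\<^sup>2 * W\<close>. The empirical logarithmic derivative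
  is \<open>omega * u0 + \<i> * t * \<sigma>0\<^sup>2 + Z / W\<close>, so the error of either estimator is at most
  \<open>sqrt 2 * |Z / W|\<close> for \<open>t \<ge> 1\<close> (\<open>estimator_errors\<close>). It remains to compare \<open>Z\<close> and \<open>W\<close> with their means.

  The contaminating locations exceed \<open>u0\<close>, so the contamination contributes at most \<open>\<epsilon>\<close> to the mean
  of \<open>W\<close>, which is therefore at least \<open>1 - 2 * \<epsilon>0 > 0\<close> in modulus (\<open>norm_mean_denominator_ge\<close>). In the mean of
  \<open>Z\<close> the main component cancels. A term of order \<open>1 / t\<close> remains, which comes from the locations, and a
  term \<open>\<epsilon> * t * scale_bias t\<close> (\<open>norm_mean_numerator_le\<close>). Each of the three alternatives makes the latter small:
  \<open>\<epsilon> * t\<close> tends to zero, or \<open>exp (- (t * \<delta> / sqrt 2))\<close> is smaller than a power of \<open>1 / t\<close> of exponent above one, or the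
  scale bias is bounded by an average over \<open>u\<close> of twice the modulus of the derivative at \<open>t\<^sup>2\<close> of the
  conditional Fourier transform, which is \<open>O(1 / t\<^sup>2)\<close> (\<open>scale_bias_Lambda_star_le\<close>).

  Finally, the summands of \<open>W\<close> and \<open>Z\<close> have second moments of order \<open>exp (A * t\<^sup>2) * (1 + t\<^sup>2)\<close>
  (\<open>second_moment_affine_exp\<close>). With \<open>t\<^sup>2 = \<gamma> * ln n\<close> and \<open>A * \<gamma> < 1\<close> this is \<open>o(n)\<close>, so
  Chebyshev's inequality gives concentration. All bounds are explicit in \<open>\<epsilon>0\<close>, \<open>A\<close>, \<open>C\<close>, \<open>t\<close>, \<open>n\<close> and the
  given sequences, whence the uniformity.
\<close>

section \<open>Averages of independent complex variables\<close>

text \<open>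
  Two distinct coordinates of a product measure are independent: the product over \<open>I\<close> of \<open>f\<close> at \<open>j\<close>,
  \<open>g\<close> at \<open>k\<close> and \<open>1\<close> elsewhere factorises.
\<close>

lemma product_integral_pair:
  fixes f g :: "'a \<Rightarrow> complex"
  assumes M: "prob_space M" and I: "finite I" "j \<in> I" "k \<in> I" "j \<noteq> k"
    and f: "integrable M f" and g: "integrable M g"
  shows "integrable (\<Pi>\<^sub>M i\<in>I. M) (\<lambda>x. f (x j) * g (x k))"
    and "(\<integral>x. f (x j) * g (x k) \<partial>(\<Pi>\<^sub>M i\<in>I. M)) = integral\<^sup>L M f * integral\<^sup>L M g"
proof -
  interpret M: prob_space M by fact
  interpret product_sigma_finite "\<lambda>_. M" by unfold_locales
  define F where "F i = (if i = j then f else if i = k then g else (\<lambda>_. 1))" for i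
  have F: "integrable M (F i)" for i unfolding F_def using f g by auto
  have I': "I = insert j (insert k (I - {j, k}))" using I by auto
  have pr: "(\<Prod>i\<in>I. F i (x i)) = f (x j) * g (x k)" for x
    using I by (subst I', subst prod.insert, simp, simp, subst prod.insert) (auto simp: F_def)
  have pr2: "(\<Prod>i\<in>I. integral\<^sup>L M (F i)) = integral\<^sup>L M f * integral\<^sup>L M g"
    using I by (subst I', subst prod.insert, simp, simp, subst prod.insert)
      (auto simp: F_def M.prob_space)
  show "integrable (\<Pi>\<^sub>M i\<in>I. M) (\<lambda>x. f (x j) * g (x k))"
    using product_integrable_prod[OF I(1), of F] F by (simp add: pr)
  show "(\<integral>x. f (x j) * g (x k) \<partial>(\<Pi>\<^sub>M i\<in>I. M)) = integral\<^sup>L M f * integral\<^sup>L M g"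
    using product_integral_prod[OF I(1), of F] F by (simp add: pr pr2)
qed

text \<open>
  Expanding the squared modulus as a double sum, the off-diagonal terms vanish by the preceding lemma
  and each diagonal term is an integral over a single coordinate.
\<close>

lemma iid_centred_sum_second_moment:
  fixes h :: "'a \<Rightarrow> complex"
  assumes M: "prob_space M" and I: "finite I"
    and h: "integrable M h" "integrable M (\<lambda>x. (cmod (h x))\<^sup>2)" "integral\<^sup>L M h = 0"
  shows "integrable (\<Pi>\<^sub>M i\<in>I. M) (\<lambda>x. (cmod (\<Sum>j\<in>I. h (x j)))\<^sup>2)"
    and "(\<integral>x. (cmod (\<Sum>j\<in>I. h (x j)))\<^sup>2 \<partial>(\<Pi>\<^sub>M i\<in>I. M)) = card I * (\<integral>x. (cmod (h x))\<^sup>2 \<partial>M)"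
proof -
  interpret M: prob_space M by fact
  let ?P = "\<Pi>\<^sub>M i\<in>I. M"
  define V where "V = (\<integral>x. (cmod (h x))\<^sup>2 \<partial>M)"
  have eq: "complex_of_real ((cmod (\<Sum>j\<in>I. h (x j)))\<^sup>2) = (\<Sum>j\<in>I. \<Sum>k\<in>I. h (x j) * cnj (h (x k)))" for x
    unfolding complex_norm_square cnj_sum sum_product ..
  have t: "integrable ?P (\<lambda>x. h (x j) * cnj (h (x k))) \<and>
     (\<integral>x. h (x j) * cnj (h (x k)) \<partial>?P) = (if j = k then of_real V else 0)"
    if jk: "j \<in> I" "k \<in> I" for j k
  proof (cases "j = k")
    case False
    show ?thesis
      using product_integral_pair[OF M I jk False h(1) integrable_cnj[OF h(1)]] False h(3)
      by simp
  next
    case True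
    have d: "distr ?P M (\<lambda>x. x j) = M"
      by (rule distr_PiM_component) (use M jk in auto)
    have hm [measurable]: "h \<in> borel_measurable M" using h(1) by auto
    have c: "(\<lambda>x. x j) \<in> measurable ?P M" using jk by measurable
    have i: "integrable M (\<lambda>x. h x * cnj (h x))"
      unfolding complex_norm_square[symmetric] using h(2) by (simp only: integrable_of_real)
    have e: "(\<integral>x. h x * cnj (h x) \<partial>M) = of_real V"
      unfolding complex_norm_square[symmetric] V_def by (simp only: integral_complex_of_real)
    show ?thesis
      using integrable_distr[OF c, of "\<lambda>x. h x * cnj (h x)"]
        integral_distr[OF c, of "\<lambda>x. h x * cnj (h x)"] i e
      unfolding d by (simp add: True[symmetric])
  qed
  have int: "integrable ?P (\<lambda>x. complex_of_real ((cmod (\<Sum>j\<in>I. h (x j)))\<^sup>2))"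
    unfolding eq using t by (intro Bochner_Integration.integrable_sum) auto
  show int': "integrable ?P (\<lambda>x. (cmod (\<Sum>j\<in>I. h (x j)))\<^sup>2)"
    using int by (simp only: integrable_of_real complex_of_real_integrable_eq)
  have "complex_of_real (\<integral>x. (cmod (\<Sum>j\<in>I. h (x j)))\<^sup>2 \<partial>?P)
      = (\<integral>x. complex_of_real ((cmod (\<Sum>j\<in>I. h (x j)))\<^sup>2) \<partial>?P)"
    by (simp only: integral_complex_of_real)
  also have "\<dots> = (\<integral>x. (\<Sum>j\<in>I. \<Sum>k\<in>I. h (x j) * cnj (h (x k))) \<partial>?P)"
    by (simp only: eq)
  also have "\<dots> = (\<Sum>j\<in>I. \<Sum>k\<in>I. if j = k then of_real V else 0)"
    by (subst Bochner_Integration.integral_sum)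
       (use t in \<open>auto intro!: sum.cong Bochner_Integration.integrable_sum simp: Bochner_Integration.integral_sum\<close>)
  also have "\<dots> = complex_of_real (card I * V)"
    using I by simp
  finally show "(\<integral>x. (cmod (\<Sum>j\<in>I. h (x j)))\<^sup>2 \<partial>?P) = card I * (\<integral>x. (cmod (h x))\<^sup>2 \<partial>M)"
    unfolding V_def by (simp only: of_real_eq_iff)
qed

lemma (in prob_space) integrable_if_second_moment_le:
  fixes f :: "'a \<Rightarrow> complex"
  assumes f [measurable]: "f \<in> borel_measurable M"
    and fB: "(\<integral>\<^sup>+x. ennreal ((cmod (f x))\<^sup>2) \<partial>M) \<le> ennreal B"
  shows "integrable M (\<lambda>x. (cmod (f x))\<^sup>2)" and "integrable M f"
proof -
  show i2: "integrable M (\<lambda>x. (cmod (f x))\<^sup>2)"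
    by (rule integrableI_bounded) (use fB in \<open>auto simp: le_less_trans[OF _ ennreal_less_top]\<close>)
  have "integrable M (\<lambda>x. cmod (f x))"
    by (rule square_integrable_imp_integrable) (use i2 in auto)
  then show "integrable M f" by (simp add: integrable_norm_iff)
qed

lemma iid_mean_Chebyshev:
  fixes f :: "'a \<Rightarrow> complex"
  assumes M: "prob_space M" and n: "0 < (n::nat)" and a: "0 < a" and B: "0 \<le> B"
    and f [measurable]: "f \<in> borel_measurable M"
    and fB: "(\<integral>\<^sup>+x. ennreal ((cmod (f x))\<^sup>2) \<partial>M) \<le> ennreal B"
  shows "emeasure (\<Pi>\<^sub>M j\<in>{1..n}. M)
      {x \<in> space (\<Pi>\<^sub>M j\<in>{1..n}. M). a \<le> cmod ((\<Sum>j=1..n. f (x j)) / of_nat n - integral\<^sup>L M f)}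
      \<le> ennreal (B / (n * a\<^sup>2))"
proof -
  interpret M: prob_space M by fact
  let ?P = "\<Pi>\<^sub>M j\<in>{1..n}. M"
  interpret P: prob_space ?P by (rule prob_space_PiM) (rule M)
  note i2 = M.integrable_if_second_moment_le(1)[OF f fB] and i1 = M.integrable_if_second_moment_le(2)[OF f fB]
  have E2: "(\<integral>x. (cmod (f x))\<^sup>2 \<partial>M) \<le> B"
    using fB B by (subst (asm) nn_integral_eq_integral[OF i2]) (auto simp: ennreal_le_iff)
  define m where "m = integral\<^sup>L M f"
  define h where "h x = f x - m" for x
  have hm [measurable]: "h \<in> borel_measurable M" unfolding h_def by measurable
  have h1: "integrable M h" unfolding h_def using i1 by auto
  have h0: "integral\<^sup>L M h = 0"
    unfolding h_def using i1 by (simp add: M.prob_space m_def)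
  have heq: "(cmod (h x))\<^sup>2 = (cmod (f x))\<^sup>2 - 2 * Re (f x * cnj m) + (cmod m)\<^sup>2" for x
    unfolding h_def cmod_power2 by (simp add: power2_eq_square algebra_simps)
  have ic: "integrable M (\<lambda>x. Re (f x * cnj m))" using i1 by auto
  have h2: "integrable M (\<lambda>x. (cmod (h x))\<^sup>2)"
    unfolding heq
    by (intro Bochner_Integration.integrable_add Bochner_Integration.integrable_diff integrable_mult_right i2 ic) simp
  have "(\<integral>x. Re (f x * cnj m) \<partial>M) = Re (m * cnj m)"
    using i1 by (subst integral_Re) (auto simp: m_def)
  also have "\<dots> = (cmod m)\<^sup>2" by (simp add: cmod_power2 flip: power2_eq_square)
  finally have "(\<integral>x. (cmod (h x))\<^sup>2 \<partial>M) = (\<integral>x. (cmod (f x))\<^sup>2 \<partial>M) - (cmod m)\<^sup>2"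
    unfolding heq using i2 ic
    by (simp add: M.prob_space Bochner_Integration.integral_diff del: times_complex.sel)
  with E2 have V: "(\<integral>x. (cmod (h x))\<^sup>2 \<partial>M) \<le> B" using zero_le_power2[of "cmod m"] by linarith
  note S = iid_centred_sum_second_moment[OF M, of "{1..n}" h, OF finite_atLeastAtMost h1 h2 h0]
  have cen: "(\<Sum>j=1..n. f (x j)) / of_nat n - m = (\<Sum>j=1..n. h (x j)) / of_nat n" for x
    using n by (simp add: h_def sum_subtractf field_simps)
  have st: "{x \<in> space ?P. a \<le> cmod ((\<Sum>j=1..n. f (x j)) / of_nat n - m)}
      = {x \<in> space ?P. (n * a)\<^sup>2 \<le> (cmod (\<Sum>j=1..n. h (x j)))\<^sup>2}"
    unfolding cen using n a
    by (intro Collect_cong conj_cong refl)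
       (simp add: norm_divide field_simps abs_le_square_iff[symmetric] flip: power_mult_distrib)
  have "emeasure ?P {x \<in> space ?P. (n * a)\<^sup>2 \<le> (cmod (\<Sum>j=1..n. h (x j)))\<^sup>2}
      \<le> ennreal ((\<integral>x. (cmod (\<Sum>j=1..n. h (x j)))\<^sup>2 \<partial>?P) / (n * a)\<^sup>2)"
    using integral_Markov_inequality[OF S(1), of "(n * a)\<^sup>2"] n a by simp
  also have "\<dots> \<le> ennreal (B / (n * a\<^sup>2))"
    unfolding S(2) using n a V by (intro ennreal_leI) (auto simp: power2_eq_square field_simps)
  finally show "emeasure ?P {x \<in> space ?P. a \<le> cmod ((\<Sum>j=1..n. f (x j)) / of_nat n - integral\<^sup>L M f)}
      \<le> ennreal (B / (n * a\<^sup>2))"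
    using st by (simp add: m_def)
qed

section \<open>Normal integrals in the direction omega\<close>

lemma exponential_tilt_normal_density:
  assumes "0 < \<sigma>"
  shows "normal_density u \<sigma> x * exp (- (s * (x - v)))
    = exp (- (s * (u - v)) + s\<^sup>2 * \<sigma>\<^sup>2 / 2) * normal_density (u - s * \<sigma>\<^sup>2) \<sigma> x"
proof -
  have "- (x - u)\<^sup>2 / (2 * \<sigma>\<^sup>2) - s * (x - v)
    = - (s * (u - v)) + s\<^sup>2 * \<sigma>\<^sup>2 / 2 - (x - (u - s * \<sigma>\<^sup>2))\<^sup>2 / (2 * \<sigma>\<^sup>2)"
    using assms by (simp add: field_simps power2_eq_square)
  then show ?thesis
    by (simp add: normal_density_def exp_add[symmetric] exp_diff[symmetric] algebra_simps)
qed

text \<open>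
  Tilting shifts the mean by \<open>- r * \<sigma>\<^sup>2\<close>; the rest is the zeroth, first and second moment of the
  shifted normal law.
\<close>

lemma nn_integral_normal_quadratic_exp:
  assumes s: "0 < \<sigma>" and ab: "0 \<le> a" "0 \<le> b"
  shows "(\<integral>\<^sup>+x. ennreal (normal_density u \<sigma> x) * ennreal ((a * (x - v)\<^sup>2 + b) * exp (- (r * (x - v)))) \<partial>lborel)
    = ennreal (exp (- (r * (u - v)) + r\<^sup>2 * \<sigma>\<^sup>2 / 2) * (a * ((u - v - r * \<sigma>\<^sup>2)\<^sup>2 + \<sigma>\<^sup>2) + b))"
proof -
  define m where "m = u - r * \<sigma>\<^sup>2"
  define E where "E = exp (- (r * (u - v)) + r\<^sup>2 * \<sigma>\<^sup>2 / 2)"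
  have eq: "normal_density u \<sigma> x * ((a * (x - v)\<^sup>2 + b) * exp (- (r * (x - v))))
     = E * (a * (normal_density m \<sigma> x * (x - m)\<^sup>2) + (2 * a * (m - v)) * (normal_density m \<sigma> x * (x - m) ^ 1)
       + (a * (m - v)\<^sup>2 + b) * normal_density m \<sigma> x)" for x
  proof -
    have "normal_density u \<sigma> x * ((a * (x - v)\<^sup>2 + b) * exp (- (r * (x - v))))
      = (a * (x - v)\<^sup>2 + b) * (normal_density u \<sigma> x * exp (- (r * (x - v))))" by simp
    also have "\<dots> = (a * (x - v)\<^sup>2 + b) * (E * normal_density m \<sigma> x)"
      unfolding exponential_tilt_normal_density[OF s] E_def m_def ..
    also have "\<dots> = E * (a * (normal_density m \<sigma> x * (x - m)\<^sup>2) + (2 * a * (m - v)) * (normal_density m \<sigma> x * (x - m) ^ 1)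
       + (a * (m - v)\<^sup>2 + b) * normal_density m \<sigma> x)"
      by algebra
    finally show ?thesis .
  qed
  have h2: "has_bochner_integral lborel (\<lambda>x. normal_density m \<sigma> x * (x - m)\<^sup>2) (\<sigma>\<^sup>2)"
    using normal_moment_even[OF s, of m 1] s by (simp add: power2_eq_square)
  have h1: "has_bochner_integral lborel (\<lambda>x. normal_density m \<sigma> x * (x - m) ^ 1) 0"
    using normal_moment_odd[OF s, of m 0] by simp
  have h0: "has_bochner_integral lborel (normal_density m \<sigma>) 1"
    using normal_moment_even[OF s, of m 0] by simp
  have "has_bochner_integral lborel (\<lambda>x. normal_density u \<sigma> x * ((a * (x - v)\<^sup>2 + b) * exp (- (r * (x - v)))))
     (E * (a * \<sigma>\<^sup>2 + (2 * a * (m - v)) * 0 + (a * (m - v)\<^sup>2 + b) * 1))"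
    unfolding eq by (intro has_bochner_integral_mult_right has_bochner_integral_add h0 h1 h2)
  moreover have "E * (a * \<sigma>\<^sup>2 + (2 * a * (m - v)) * 0 + (a * (m - v)\<^sup>2 + b) * 1)
     = exp (- (r * (u - v)) + r\<^sup>2 * \<sigma>\<^sup>2 / 2) * (a * ((u - v - r * \<sigma>\<^sup>2)\<^sup>2 + \<sigma>\<^sup>2) + b)"
    by (simp add: E_def m_def algebra_simps)
  ultimately have hb: "has_bochner_integral lborel (\<lambda>x. normal_density u \<sigma> x * ((a * (x - v)\<^sup>2 + b) * exp (- (r * (x - v)))))
     (exp (- (r * (u - v)) + r\<^sup>2 * \<sigma>\<^sup>2 / 2) * (a * ((u - v - r * \<sigma>\<^sup>2)\<^sup>2 + \<sigma>\<^sup>2) + b))" by simp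
  have "(\<integral>\<^sup>+x. ennreal (normal_density u \<sigma> x) * ennreal ((a * (x - v)\<^sup>2 + b) * exp (- (r * (x - v)))) \<partial>lborel)
     = (\<integral>\<^sup>+x. ennreal (normal_density u \<sigma> x * ((a * (x - v)\<^sup>2 + b) * exp (- (r * (x - v))))) \<partial>lborel)"
    by (intro nn_integral_cong) (simp add: ennreal_mult')
  also have "\<dots> = ennreal (integral\<^sup>L lborel (\<lambda>x. normal_density u \<sigma> x * ((a * (x - v)\<^sup>2 + b) * exp (- (r * (x - v))))))"
    using hb ab by (intro nn_integral_eq_integral) (auto intro: integrable.intros)
  finally show ?thesis using has_bochner_integral_integral_eq[OF hb] by simp
qed

text \<open>
  A second moment allows differentiation under the integral sign, because the remainder of \<open>iexp\<close>
  after its linear term is at most half the square of its argument. The lemma serves twice: for the first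
  moment of the standard normal law, and for the conditional densities of the scale parameter.
\<close>

lemma has_vector_derivative_Fourier:
  fixes p :: "real \<Rightarrow> real"
  assumes p0: "\<And>x. 0 \<le> p x" and p: "integrable lborel p" and p2: "integrable lborel (\<lambda>x. x\<^sup>2 * p x)"
  shows "((\<lambda>s. \<integral>x. iexp (s * x) * complex_of_real (p x) \<partial>lborel) has_vector_derivative
      (\<integral>x. \<i> * of_real x * iexp (s * x) * complex_of_real (p x) \<partial>lborel)) (at s)"
    and "integrable lborel (\<lambda>x. of_real x * iexp (s * x) * complex_of_real (p x))"
proof -
  have [measurable]: "p \<in> borel_measurable borel" using p by auto
  have p1: "integrable lborel (\<lambda>x. \<bar>x\<bar> * p x)"
  proof (rule Bochner_Integration.integrable_bound[where f = "\<lambda>x. p x + x\<^sup>2 * p x"])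
    show "integrable lborel (\<lambda>x. p x + x\<^sup>2 * p x)" using p p2 by simp
    show "AE x in lborel. norm (\<bar>x\<bar> * p x) \<le> norm (p x + x\<^sup>2 * p x)"
    proof (rule AE_I2)
      fix x :: real
      have "2 * \<bar>x\<bar> \<le> 1 + x\<^sup>2" using zero_le_power2[of "\<bar>x\<bar> - 1"] by (simp add: power2_diff)
      then have "\<bar>x\<bar> \<le> 1 + x\<^sup>2" by linarith
      then have "\<bar>x\<bar> * p x \<le> (1 + x\<^sup>2) * p x" using p0 by (intro mult_right_mono)
      then show "norm (\<bar>x\<bar> * p x) \<le> norm (p x + x\<^sup>2 * p x)"
        using p0[of x] by (simp add: abs_mult algebra_simps)
    qed
  qed measurable
  let ?F = "\<lambda>s. \<integral>x. iexp (s * x) * complex_of_real (p x) \<partial>lborel"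
  let ?d = "\<lambda>s x. \<i> * of_real x * iexp (s * x) * complex_of_real (p x)"
  have i0: "integrable lborel (\<lambda>x. iexp (s * x) * complex_of_real (p x))" for s
    by (rule Bochner_Integration.integrable_bound[OF p]) (auto simp: norm_mult)
  show i1: "integrable lborel (\<lambda>x. of_real x * iexp (s * x) * complex_of_real (p x))" for s
    by (rule Bochner_Integration.integrable_bound[OF p1]) (auto simp: norm_mult)
  have i1': "integrable lborel (?d s)" for s
    using integrable_mult_right[OF i1, of \<i> s] by (simp only: mult.assoc)
  define K where "K = (\<integral>x. x\<^sup>2 * p x \<partial>lborel)"
  have K0: "0 \<le> K" unfolding K_def using p0 by simp
  have main: "norm (?F y - ?F s - (y - s) *\<^sub>R integral\<^sup>L lborel (?d s)) \<le> (y - s)\<^sup>2 / 2 * K" for y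
  proof -
    have ig: "integrable lborel (\<lambda>x. iexp (y * x) * complex_of_real (p x) - iexp (s * x) * complex_of_real (p x) - (y - s) *\<^sub>R ?d s x)"
      using i0 i1' by (intro Bochner_Integration.integrable_diff) auto
    have 1: "?F y - ?F s - (y - s) *\<^sub>R integral\<^sup>L lborel (?d s)
      = (\<integral>x. iexp (y * x) * complex_of_real (p x) - iexp (s * x) * complex_of_real (p x) - (y - s) *\<^sub>R ?d s x \<partial>lborel)"
      unfolding Bochner_Integration.integral_diff[OF Bochner_Integration.integrable_diff[OF i0 i0] integrable_scaleR_right[OF i1']]
        Bochner_Integration.integral_diff[OF i0 i0] integral_scaleR_right ..
    have 2: "norm (\<integral>x. iexp (y * x) * complex_of_real (p x) - iexp (s * x) * complex_of_real (p x) - (y - s) *\<^sub>R ?d s x \<partial>lborel) \<le> (\<integral>x. (y - s)\<^sup>2 / 2 * (x\<^sup>2 * p x) \<partial>lborel)"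
    proof (rule Bochner_Integration.integral_norm_bound_integral[OF ig])
      show "integrable lborel (\<lambda>x. (y - s)\<^sup>2 / 2 * (x\<^sup>2 * p x))" using p2 by simp
      fix x :: real
      have e: "iexp (y * x) = iexp (s * x) * iexp ((y - s) * x)"
        by (simp add: exp_add[symmetric] algebra_simps)
      have 3: "iexp (y * x) * complex_of_real (p x) - iexp (s * x) * complex_of_real (p x) - (y - s) *\<^sub>R ?d s x
        = iexp (s * x) * of_real (p x) * (iexp ((y - s) * x) - (\<Sum>k\<le>1. (\<i> * of_real ((y - s) * x))^k / fact k))"
        unfolding e by (simp add: scaleR_conv_of_real algebra_simps)
      have "norm (iexp (s * x) * of_real (p x) * (iexp ((y - s) * x) - (\<Sum>k\<le>1. (\<i> * of_real ((y - s) * x))^k / fact k))) \<le> p x * (\<bar>(y - s) * x\<bar> ^ 2 / 2)"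
        using iexp_approx1[of "(y - s) * x" 1] p0[of x]
        by (simp only: norm_mult norm_exp_i_times norm_of_real abs_of_nonneg mult_1)
           (rule mult_left_mono, simp_all add: numeral_2_eq_2)
      also have "\<dots> = (y - s)\<^sup>2 / 2 * (x\<^sup>2 * p x)"
        by (simp add: power_mult_distrib)
      finally show "norm (iexp (y * x) * complex_of_real (p x) - iexp (s * x) * complex_of_real (p x) - (y - s) *\<^sub>R ?d s x)
         \<le> (y - s)\<^sup>2 / 2 * (x\<^sup>2 * p x)"
        unfolding 3 .
    qed
    show ?thesis
      using 2 unfolding 1 K_def integral_mult_right_zero .
  qed
  have quot: "norm (G /\<^sub>R norm h) \<le> \<bar>h\<bar> / 2 * K" if "norm G \<le> h\<^sup>2 / 2 * K" "h \<noteq> 0" for G :: complex and h :: real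
  proof -
    have "norm (G /\<^sub>R norm h) = norm G / \<bar>h\<bar>" by (simp add: divide_inverse mult.commute)
    also have "\<dots> \<le> (h\<^sup>2 / 2 * K) / \<bar>h\<bar>" using that(1) by (rule divide_right_mono) simp
    also have "\<dots> = \<bar>h\<bar> / 2 * K"
      using that(2) by (cases "0 < h") (simp_all add: power2_eq_square)
    finally show ?thesis .
  qed
  show "(?F has_vector_derivative integral\<^sup>L lborel (?d s)) (at s)"
    unfolding has_vector_derivative_def
  proof (rule has_derivativeI)
    show "bounded_linear (\<lambda>x. x *\<^sub>R integral\<^sup>L lborel (?d s))" by (rule bounded_linear_scaleR_left)
    show "(\<lambda>y. ((?F y - ?F s) - (y - s) *\<^sub>R integral\<^sup>L lborel (?d s)) /\<^sub>R norm (y - s)) \<midarrow>s\<rightarrow> 0"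
    proof (rule Lim_null_comparison)
      show "\<forall>\<^sub>F y in at s. norm (((?F y - ?F s) - (y - s) *\<^sub>R integral\<^sup>L lborel (?d s)) /\<^sub>R norm (y - s)) \<le> \<bar>y - s\<bar> / 2 * K"
        unfolding eventually_at_filter
      proof (intro always_eventually allI impI)
        fix y assume "y \<noteq> s"
        then show "norm (((?F y - ?F s) - (y - s) *\<^sub>R integral\<^sup>L lborel (?d s)) /\<^sub>R norm (y - s)) \<le> \<bar>y - s\<bar> / 2 * K"
          by (intro quot main) simp
      qed
      show "((\<lambda>y. \<bar>y - s\<bar> / 2 * K) \<longlongrightarrow> 0) (at s)"
        by (auto intro!: tendsto_eq_intros)
    qed
  qed
qed

text \<open>
  The first moment comes from differentiating the characteristic function twice over: under the integral
  sign and in closed form.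
\<close>

lemma std_normal_Fourier:
  "(\<integral>x. iexp (s * x) * complex_of_real (std_normal_density x) \<partial>lborel) = of_real (exp (- s\<^sup>2 / 2))"
  "(\<integral>x. of_real x * iexp (s * x) * complex_of_real (std_normal_density x) \<partial>lborel)
     = \<i> * of_real s * of_real (exp (- s\<^sup>2 / 2))"
  "integrable lborel (\<lambda>x. iexp (s * x) * complex_of_real (std_normal_density x))"
  "integrable lborel (\<lambda>x. of_real x * iexp (s * x) * complex_of_real (std_normal_density x))"
proof -
  have p2: "integrable lborel (\<lambda>x. x\<^sup>2 * std_normal_density x)"
    using integrable_std_normal_moment[of 2] by (simp add: mult.commute)
  have p: "integrable lborel std_normal_density" by simp
  note D = has_vector_derivative_Fourier[OF _ p p2]
  show c: "(\<integral>x. iexp (s * x) * complex_of_real (std_normal_density x) \<partial>lborel) = of_real (exp (- s\<^sup>2 / 2))" for s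
  proof -
    have "char std_normal_distribution s = (\<integral>x. std_normal_density x *\<^sub>R iexp (s * x) \<partial>lborel)"
      unfolding char_def by (subst integral_density) auto
    then show ?thesis
      unfolding char_std_normal_distribution by (simp add: scaleR_conv_of_real mult.commute)
  qed
  have "((\<lambda>s. complex_of_real (exp (- s\<^sup>2 / 2))) has_vector_derivative
     (\<integral>x. \<i> * of_real x * iexp (s * x) * complex_of_real (std_normal_density x) \<partial>lborel)) (at s)"
    using D(1)[of s] unfolding c by simp
  moreover have "((\<lambda>s. complex_of_real (exp (- s\<^sup>2 / 2))) has_vector_derivative of_real (- s * exp (- s\<^sup>2 / 2))) (at s)"
    by (rule has_vector_derivative_of_real)
       (auto intro!: derivative_eq_intros simp: has_real_derivative_iff_has_vector_derivative[symmetric])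
  ultimately have "(\<integral>x. \<i> * of_real x * iexp (s * x) * complex_of_real (std_normal_density x) \<partial>lborel)
      = of_real (- s * exp (- s\<^sup>2 / 2))"
    by (rule vector_derivative_unique_at)
  then have "\<i> * (\<integral>x. of_real x * iexp (s * x) * complex_of_real (std_normal_density x) \<partial>lborel)
      = of_real (- s * exp (- s\<^sup>2 / 2))"
    by (simp only: mult.assoc integral_mult_right_zero)
  then have "\<i> * (\<i> * (\<integral>x. of_real x * iexp (s * x) * complex_of_real (std_normal_density x) \<partial>lborel))
      = \<i> * of_real (- s * exp (- s\<^sup>2 / 2))" by simp
  then show "(\<integral>x. of_real x * iexp (s * x) * complex_of_real (std_normal_density x) \<partial>lborel)
     = \<i> * of_real s * of_real (exp (- s\<^sup>2 / 2))"
    by (simp add: mult.assoc[symmetric] minus_equation_iff)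
  show "integrable lborel (\<lambda>x. iexp (s * x) * complex_of_real (std_normal_density x))"
    by (rule Bochner_Integration.integrable_bound[OF p]) (auto simp: norm_mult)
  show "integrable lborel (\<lambda>x. of_real x * iexp (s * x) * complex_of_real (std_normal_density x))"
    by (rule D(2)) simp
qed

lemma omega_mult_eq: "omega * of_real t = - ((1 + \<i>) * of_real (t / sqrt 2))"
  by (simp only: omega_def of_real_divide times_divide_eq_left times_divide_eq_right minus_mult_left minus_divide_left)

lemma integral_normal_standardise:
  fixes F :: "real \<Rightarrow> complex"
  assumes "0 < \<sigma>"
  shows "(\<integral>x. of_real (normal_density u \<sigma> x) * F x \<partial>lborel)
    = (\<integral>z. of_real (std_normal_density z) * F (u + \<sigma> * z) \<partial>lborel)"
proof -
  have "normal_density u \<sigma> (u + \<sigma> * z) = std_normal_density z / \<sigma>" for z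
    using assms by (simp add: normal_density_def real_sqrt_mult power_mult_distrib)
  moreover have "(\<integral>x. of_real (normal_density u \<sigma> x) * F x \<partial>lborel)
    = (\<integral>z. \<sigma> *\<^sub>R (of_real (normal_density u \<sigma> (u + \<sigma> * z)) * F (u + \<sigma> * z)) \<partial>lborel)"
    using assms by (subst lborel_integral_real_affine[where c = \<sigma> and t = u]) simp_all
  ultimately show ?thesis
    using assms by (simp only:) (simp add: scaleR_conv_of_real)
qed

text \<open>
  Since \<open>omega * t = - (1 + \<i>) * r\<close> with \<open>r = t / sqrt 2\<close>, the complex exponential splits into a real
  exponential, removed by tilting, and a pure oscillation of frequency \<open>- r\<close>. The tilt contributes the
  factor \<open>exp (r\<^sup>2 * \<sigma>\<^sup>2 / 2)\<close>, which the Gaussian decay \<open>exp (- r\<^sup>2 * \<sigma>\<^sup>2 / 2)\<close> of the oscillating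
  integral cancels exactly, so that \<open>\<sigma>\<close> enters the result only through a phase.
\<close>

lemma integral_normal_affine_exp:
  assumes s: "0 < \<sigma>"
  shows "(\<integral>x. of_real (normal_density u \<sigma> x) *
        ((p * of_real (x - v) + q) * exp (omega * of_real (t * (x - v)))) \<partial>lborel)
    = (p * (of_real (u - v) + omega * of_real (t * \<sigma>\<^sup>2)) + q)
       * exp (omega * of_real (t * (u - v)) + \<i> * of_real (t\<^sup>2 * \<sigma>\<^sup>2 / 2))"
proof -
  define r where "r = t / sqrt 2"
  have r2: "r\<^sup>2 = t\<^sup>2 / 2" by (simp add: r_def power_divide)
  define m where "m = u - v - r * \<sigma>\<^sup>2"
  define E where "E = exp (- (r * (u - v)) + r\<^sup>2 * \<sigma>\<^sup>2 / 2)"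
  define \<Theta> where "\<Theta> = iexp (- (r * m))"
  have w: "omega * of_real (t * y) = - (of_real (r * y)) + \<i> * of_real (- (r * y))" for y
    using omega_mult_eq[of "t * y"] by (simp add: r_def algebra_simps add_divide_distrib)
  have we: "exp (omega * of_real (t * y)) = of_real (exp (- (r * y))) * iexp (- (r * y))" for y
    unfolding w exp_add by (simp add: exp_of_real[symmetric] del: of_real_mult)
  have "of_real (normal_density u \<sigma> x) * ((p * of_real (x - v) + q) * exp (omega * of_real (t * (x - v))))
    = of_real E * (of_real (normal_density (u - r * \<sigma>\<^sup>2) \<sigma> x) * ((p * of_real (x - v) + q) * iexp (- (r * (x - v)))))"
    (is "?L x = ?R x") for x
  proof -
    have "?L x = of_real (normal_density u \<sigma> x * exp (- (r * (x - v)))) * ((p * of_real (x - v) + q) * iexp (- (r * (x - v))))"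
      unfolding we by (simp only: of_real_mult mult_ac)
    also have "\<dots> = ?R x"
      unfolding exponential_tilt_normal_density[OF s] E_def[symmetric] by (simp only: of_real_mult mult_ac)
    finally show ?thesis .
  qed
  then have "(\<integral>x. of_real (normal_density u \<sigma> x) *
        ((p * of_real (x - v) + q) * exp (omega * of_real (t * (x - v)))) \<partial>lborel)
     = of_real E * (\<integral>x. of_real (normal_density (u - r * \<sigma>\<^sup>2) \<sigma> x) * ((p * of_real (x - v) + q) * iexp (- (r * (x - v)))) \<partial>lborel)"
    by (simp only: integral_mult_right_zero)
  also have "(\<integral>x. of_real (normal_density (u - r * \<sigma>\<^sup>2) \<sigma> x) * ((p * of_real (x - v) + q) * iexp (- (r * (x - v)))) \<partial>lborel)
     = (\<integral>z. of_real (std_normal_density z) * ((p * of_real (u - r * \<sigma>\<^sup>2 + \<sigma> * z - v) + q) * iexp (- (r * (u - r * \<sigma>\<^sup>2 + \<sigma> * z - v)))) \<partial>lborel)"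
    by (rule integral_normal_standardise[OF s])
  also have "\<dots> = (\<integral>z. (p * of_real m + q) * \<Theta> * (iexp ((- (r * \<sigma>)) * z) * of_real (std_normal_density z))
      + p * of_real \<sigma> * \<Theta> * (of_real z * iexp ((- (r * \<sigma>)) * z) * of_real (std_normal_density z)) \<partial>lborel)"
  proof (intro Bochner_Integration.integral_cong refl)
    fix z :: real
    have 1: "u - r * \<sigma>\<^sup>2 + \<sigma> * z - v = m + \<sigma> * z" by (simp add: m_def)
    have 2: "iexp (- (r * (m + \<sigma> * z))) = \<Theta> * iexp ((- (r * \<sigma>)) * z)"
      unfolding \<Theta>_def exp_add[symmetric] by (simp add: algebra_simps)
    show "of_real (std_normal_density z) * ((p * of_real (u - r * \<sigma>\<^sup>2 + \<sigma> * z - v) + q) * iexp (- (r * (u - r * \<sigma>\<^sup>2 + \<sigma> * z - v))))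
      = (p * of_real m + q) * \<Theta> * (iexp ((- (r * \<sigma>)) * z) * of_real (std_normal_density z))
      + p * of_real \<sigma> * \<Theta> * (of_real z * iexp ((- (r * \<sigma>)) * z) * of_real (std_normal_density z))"
      unfolding 1 2 by (simp only: of_real_add of_real_mult) algebra
  qed
  also have "\<dots> = (p * of_real m + q) * \<Theta> * of_real (exp (- (- (r * \<sigma>))\<^sup>2 / 2))
      + p * of_real \<sigma> * \<Theta> * (\<i> * of_real (- (r * \<sigma>)) * of_real (exp (- (- (r * \<sigma>))\<^sup>2 / 2)))"
    by (subst Bochner_Integration.integral_add)
       (intro integrable_mult_right std_normal_Fourier, intro integrable_mult_right std_normal_Fourier,
        simp only: integral_mult_right_zero std_normal_Fourier)
  also have "\<dots> = of_real (exp (- (r\<^sup>2 * \<sigma>\<^sup>2) / 2)) * \<Theta> * (p * (of_real m - \<i> * of_real (r * \<sigma>\<^sup>2)) + q)"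
    by (simp add: power_mult_distrib power2_eq_square algebra_simps)
  also have "of_real m - \<i> * of_real (r * \<sigma>\<^sup>2) = of_real (u - v) + omega * of_real (t * \<sigma>\<^sup>2)"
    unfolding w m_def by (simp add: algebra_simps)
  also have "of_real E * (of_real (exp (- (r\<^sup>2 * \<sigma>\<^sup>2) / 2)) * \<Theta> * (p * (of_real (u - v) + omega * of_real (t * \<sigma>\<^sup>2)) + q))
    = (p * (of_real (u - v) + omega * of_real (t * \<sigma>\<^sup>2)) + q) * (of_real E * of_real (exp (- (r\<^sup>2 * \<sigma>\<^sup>2) / 2)) * \<Theta>)"
    by simp
  also have "of_real E * of_real (exp (- (r\<^sup>2 * \<sigma>\<^sup>2) / 2)) * \<Theta>
    = exp (omega * of_real (t * (u - v)) + \<i> * of_real (t\<^sup>2 * \<sigma>\<^sup>2 / 2))"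
  proof -
    have "of_real E * of_real (exp (- (r\<^sup>2 * \<sigma>\<^sup>2) / 2)) = complex_of_real (exp (- (r * (u - v))))"
      unfolding E_def of_real_mult[symmetric] exp_add[symmetric] by simp
    moreover have "\<Theta> = iexp (- (r * (u - v))) * exp (\<i> * of_real (t\<^sup>2 * \<sigma>\<^sup>2 / 2))"
    proof -
      have e: "t\<^sup>2 * \<sigma>\<^sup>2 / 2 = r\<^sup>2 * \<sigma>\<^sup>2" using r2 by simp
      show ?thesis
        unfolding \<Theta>_def m_def e exp_add[symmetric] by (simp add: algebra_simps power2_eq_square)
    qed
    ultimately show ?thesis unfolding exp_add we by simp
  qed
  finally show ?thesis .
qed

lemma Re_omega: "Re omega = - 1 / sqrt 2"
  by (simp add: omega_def Re_divide_of_real)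

lemma norm_omega: "cmod omega = 1"
proof -
  have "(cmod omega)\<^sup>2 = cmod (omega\<^sup>2)" by (simp add: norm_power)
  then have "(cmod omega)\<^sup>2 = 1" by (simp add: omega_squared)
  then show ?thesis by (simp add: power2_eq_1_iff) (smt (verit) norm_ge_zero)
qed

lemma norm_exp_omega: "cmod (exp (omega * of_real s)) = exp (- (s / sqrt 2))"
  by (simp add: norm_exp_eq_Re Re_omega)

lemma (in prob_space) norm_integral_le_const:
  fixes f :: "'a \<Rightarrow> complex"
  assumes "AE x in M. norm (f x) \<le> B" and "0 \<le> B"
  shows "norm (integral\<^sup>L M f) \<le> B"
proof (cases "integrable M f")
  case True
  have "norm (integral\<^sup>L M f) \<le> (\<integral>x. norm (f x) \<partial>M)" by (rule integral_norm_bound)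
  also have "\<dots> \<le> (\<integral>x. B \<partial>M)" using True assms by (intro integral_mono_AE) auto
  finally show ?thesis by (simp add: prob_space)
qed (use assms(2) in \<open>simp add: not_integrable_integral_eq\<close>)

lemma mult_exp_neg_le_1: "y * exp (- y) \<le> (1::real)"
proof -
  have "y \<le> exp y" using exp_ge_add_one_self[of y] by linarith
  then have "y * exp (- y) \<le> exp y * exp (- y)" by (rule mult_right_mono) simp
  then show ?thesis by (simp add: exp_minus)
qed

lemma power2_mult_exp_neg_le_2: "0 \<le> y \<Longrightarrow> y\<^sup>2 * exp (- y) \<le> (2::real)"
proof -
  assume "0 \<le> y"
  then have "y\<^sup>2 \<le> 2 * exp y" using exp_lower_Taylor_quadratic[of y] by linarith
  then show ?thesis by (simp add: exp_minus field_simps)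
qed

section \<open>Integrals against a contaminated normal law\<close>

text \<open>
  A fixed member of the class of mixtures. The three probability-one conditions on the mixing law are
  merged into one almost-everywhere statement, the form in which they are applied under integrals.
\<close>

locale normal_contamination =
  fixes u0 \<sigma>0 \<epsilon> A :: real and H :: "(real \<times> real) measure"
  assumes sigma0: "0 < \<sigma>0" "\<sigma>0\<^sup>2 \<le> A"
    and eps: "0 < \<epsilon>" "\<epsilon> \<le> 1"
    and prob_H: "prob_space H"
    and sets_H: "sets H = sets borel"
    and AE_H: "AE z in H. u0 < fst z \<and> 0 < snd z \<and> (snd z)\<^sup>2 \<le> A"
begin

sublocale H: prob_space H by (rule prob_H)

lemma sets_H_pair [measurable_cong]: "sets H = sets (borel \<Otimes>\<^sub>M borel)"
  using sets_H by (simp only: borel_prod)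

abbreviation X_law :: "real measure" where
  "X_law \<equiv> density lborel (mix_density u0 \<sigma>0 \<epsilon> H)"

lemma measure_scale_pos: "measure H {(u, \<sigma>). 0 < \<sigma>} = 1"
proof (rule H.prob_eq_1[THEN iffD2])
  have "{z. 0 < snd z} = {z \<in> space H. 0 < snd z}"
    using sets_eq_imp_space_eq[OF sets_H] by simp
  then show "{(u, \<sigma>). 0 < \<sigma>} \<in> H.events"
    by (simp add: case_prod_beta')
qed (use AE_H in auto)

lemma borel_measurable_mix_density: "mix_density u0 \<sigma>0 \<epsilon> H \<in> borel_measurable lborel"
  and prob_space_X_law: "prob_space X_law"
  using prob_space_mix_density[OF sigma0(1) _ eps(2) prob_H sets_H measure_scale_pos] eps by auto

lemma nn_integral_X_law:
  assumes g [measurable]: "g \<in> borel_measurable borel"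
  shows "(\<integral>\<^sup>+x. g x \<partial>X_law) =
    ennreal (1 - \<epsilon>) * (\<integral>\<^sup>+x. ennreal (normal_density u0 \<sigma>0 x) * g x \<partial>lborel)
    + ennreal \<epsilon> * (\<integral>\<^sup>+z. (\<integral>\<^sup>+x. ennreal (normal_density (fst z) (snd z) x) * g x \<partial>lborel) \<partial>H)"
proof -
  interpret P: pair_sigma_finite lborel H ..
  have m [measurable]: "(\<lambda>(x, z). ennreal (normal_density (fst z) (snd z) x)) \<in> borel_measurable (lborel \<Otimes>\<^sub>M H)"
    unfolding normal_density_def by measurable
  have m1 [measurable]: "(\<lambda>x. \<integral>\<^sup>+z. ennreal (normal_density (fst z) (snd z) x) \<partial>H) \<in> borel_measurable lborel"
    by measurable
  have m2: "(\<lambda>z. ennreal (normal_density (fst z) (snd z) x)) \<in> borel_measurable H" for x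
    unfolding normal_density_def by measurable
  have "(\<integral>\<^sup>+x. g x \<partial>X_law) = (\<integral>\<^sup>+x. mix_density u0 \<sigma>0 \<epsilon> H x * g x \<partial>lborel)"
    using borel_measurable_mix_density by (subst nn_integral_density) auto
  also have "\<dots> = (\<integral>\<^sup>+x. ennreal (1 - \<epsilon>) * (ennreal (normal_density u0 \<sigma>0 x) * g x) +
       ennreal \<epsilon> * (\<integral>\<^sup>+z. ennreal (normal_density (fst z) (snd z) x) * g x \<partial>H) \<partial>lborel)"
    using eps by (intro nn_integral_cong)
      (simp add: mix_density_def case_prod_beta' nn_integral_multc[OF m2] distrib_right ennreal_mult' mult.assoc)
  also have "\<dots> = ennreal (1 - \<epsilon>) * (\<integral>\<^sup>+x. ennreal (normal_density u0 \<sigma>0 x) * g x \<partial>lborel)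
       + ennreal \<epsilon> * (\<integral>\<^sup>+x. (\<integral>\<^sup>+z. ennreal (normal_density (fst z) (snd z) x) * g x \<partial>H) \<partial>lborel)"
    by (simp add: nn_integral_add nn_integral_cmult)
  also have "(\<integral>\<^sup>+x. (\<integral>\<^sup>+z. ennreal (normal_density (fst z) (snd z) x) * g x \<partial>H) \<partial>lborel)
      = (\<integral>\<^sup>+z. (\<integral>\<^sup>+x. ennreal (normal_density (fst z) (snd z) x) * g x \<partial>lborel) \<partial>H)"
    by (rule P.Fubini'[symmetric]) measurable
  finally show ?thesis .
qed

lemma nn_integral_X_law_le:
  assumes g: "g \<in> borel_measurable borel"
    and le: "\<And>u \<sigma>. u0 \<le> u \<Longrightarrow> 0 < \<sigma> \<Longrightarrow> \<sigma>\<^sup>2 \<le> A \<Longrightarrow>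
      (\<integral>\<^sup>+x. ennreal (normal_density u \<sigma> x) * g x \<partial>lborel) \<le> B"
  shows "(\<integral>\<^sup>+x. g x \<partial>X_law) \<le> B"
proof -
  have "(\<integral>\<^sup>+z. (\<integral>\<^sup>+x. ennreal (normal_density (fst z) (snd z) x) * g x \<partial>lborel) \<partial>H) \<le> (\<integral>\<^sup>+z. B \<partial>H)"
  proof (rule nn_integral_mono_AE)
    show "AE z in H. (\<integral>\<^sup>+x. ennreal (normal_density (fst z) (snd z) x) * g x \<partial>lborel) \<le> B"
      using AE_H by (rule eventually_mono) (simp add: le)
  qed
  also have "\<dots> = B" by (simp add: H.emeasure_space_1)
  finally have "(\<integral>\<^sup>+x. g x \<partial>X_law) \<le> ennreal (1 - \<epsilon>) * B + ennreal \<epsilon> * B"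
    unfolding nn_integral_X_law[OF g] using le[of u0 \<sigma>0] sigma0
    by (intro add_mono mult_left_mono) auto
  also have "\<dots> = B"
    using eps by (simp add: distrib_right[symmetric] ennreal_plus[symmetric] del: ennreal_plus)
  finally show ?thesis .
qed

text \<open>
  The mixture density may be infinite on a null set, so it is replaced by a real-valued version before
  Fubini's theorem is applied to the product of Lebesgue measure and \<open>H\<close>.
\<close>

lemma integral_X_law:
  fixes g :: "real \<Rightarrow> complex"
  assumes int: "integrable X_law g"
  shows "integral\<^sup>L X_law g =
    of_real (1 - \<epsilon>) * (\<integral>x. of_real (normal_density u0 \<sigma>0 x) * g x \<partial>lborel)
    + of_real \<epsilon> * (\<integral>z. (\<integral>x. of_real (normal_density (fst z) (snd z) x) * g x \<partial>lborel) \<partial>H)"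
    and "integrable H (\<lambda>z. (\<integral>x. of_real (normal_density (fst z) (snd z) x) * g x \<partial>lborel))"
proof -
  interpret P: pair_sigma_finite lborel H ..
  have g [measurable]: "g \<in> borel_measurable borel" using int by auto
  define q where "q x = (\<integral>\<^sup>+z. ennreal (normal_density (fst z) (snd z) x) \<partial>H)" for x
  have m [measurable]: "(\<lambda>(x, z). normal_density (fst z) (snd z) x) \<in> borel_measurable (lborel \<Otimes>\<^sub>M H)"
    unfolding normal_density_def by measurable
  have m2: "(\<lambda>z. normal_density (fst z) (snd z) x) \<in> borel_measurable H" for x
    unfolding normal_density_def by measurable
  have q [measurable]: "q \<in> borel_measurable lborel"
    unfolding q_def by measurable
  let ?N = "\<lambda>z x. complex_of_real (normal_density (fst z) (snd z) x) * g x"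
  have fin: "(\<integral>\<^sup>+x. ennreal (cmod (g x)) \<partial>X_law) < \<infinity>"
    using int by (auto simp: integrable_iff_bounded)
  have split: "(\<integral>\<^sup>+x. ennreal (cmod (g x)) \<partial>X_law) =
    ennreal (1 - \<epsilon>) * (\<integral>\<^sup>+x. ennreal (normal_density u0 \<sigma>0 x) * ennreal (cmod (g x)) \<partial>lborel)
    + ennreal \<epsilon> * (\<integral>\<^sup>+z. (\<integral>\<^sup>+x. ennreal (normal_density (fst z) (snd z) x) * ennreal (cmod (g x)) \<partial>lborel) \<partial>H)"
    by (rule nn_integral_X_law) measurable
  have "(\<integral>\<^sup>+z. (\<integral>\<^sup>+x. ennreal (normal_density (fst z) (snd z) x) * ennreal (cmod (g x)) \<partial>lborel) \<partial>H) < \<infinity>"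
    using fin eps unfolding split by (auto simp: ennreal_mult_less_top ennreal_mult_eq_top_iff less_top)
  also have "(\<integral>\<^sup>+z. (\<integral>\<^sup>+x. ennreal (normal_density (fst z) (snd z) x) * ennreal (cmod (g x)) \<partial>lborel) \<partial>H)
     = (\<integral>\<^sup>+z. (\<integral>\<^sup>+x. ennreal (norm (?N z x)) \<partial>lborel) \<partial>H)"
    by (intro nn_integral_cong) (simp add: norm_mult ennreal_mult')
  also have "\<dots> = (\<integral>\<^sup>+y. ennreal (norm ((\<lambda>(x, z). ?N z x) y)) \<partial>(lborel \<Otimes>\<^sub>M H))"
    by (subst P.nn_integral_snd[symmetric]) (auto simp: case_prod_beta')
  finally have pint: "integrable (lborel \<Otimes>\<^sub>M H) (\<lambda>(x, z). ?N z x)"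
    by (intro integrableI_bounded) auto
  show "integrable H (\<lambda>z. (\<integral>x. ?N z x \<partial>lborel))"
    using P.integrable_snd[OF pint] .
  have fub: "(\<integral>x. (\<integral>z. ?N z x \<partial>H) \<partial>lborel) = (\<integral>z. (\<integral>x. ?N z x \<partial>lborel) \<partial>H)"
    using P.Fubini_integral[OF pint] by simp
  have i2: "integrable lborel (\<lambda>x. \<integral>z. ?N z x \<partial>H)"
    using P.integrable_fst[OF pint] .
  have inner: "(\<integral>z. ?N z x \<partial>H) = of_real (enn2real (q x)) * g x" for x
  proof -
    have "(\<integral>z. complex_of_real (normal_density (fst z) (snd z) x) \<partial>H)
       = of_real (\<integral>z. normal_density (fst z) (snd z) x \<partial>H)"
      by simp
    also have "\<dots> = of_real (enn2real (q x))"
      unfolding q_def using m2 by (subst integral_eq_nn_integral) auto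
    finally show ?thesis by simp
  qed
  have qfin: "AE x in lborel. q x \<noteq> \<infinity>"
  proof -
    have "AE x in lborel. mix_density u0 \<sigma>0 \<epsilon> H x \<noteq> \<infinity>"
    proof (rule nn_integral_PInf_AE)
      show "mix_density u0 \<sigma>0 \<epsilon> H \<in> borel_measurable lborel" by (rule borel_measurable_mix_density)
      have "(\<integral>\<^sup>+x. mix_density u0 \<sigma>0 \<epsilon> H x \<partial>lborel) = emeasure X_law (space X_law)"
        using borel_measurable_mix_density by (simp add: emeasure_density)
      then show "(\<integral>\<^sup>+x. mix_density u0 \<sigma>0 \<epsilon> H x \<partial>lborel) \<noteq> \<infinity>"
        using prob_space.emeasure_space_1[OF prob_space_X_law] by simp
    qed
    then show ?thesis
      using eps by (auto simp: mix_density_def q_def case_prod_beta' ennreal_mult_eq_top_iff elim!: eventually_mono)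
  qed
  define m' where "m' x = (1 - \<epsilon>) * normal_density u0 \<sigma>0 x + \<epsilon> * enn2real (q x)" for x
  have m'_meas [measurable]: "m' \<in> borel_measurable lborel" unfolding m'_def by measurable
  have m'0: "0 \<le> m' x" for x using eps by (simp add: m'_def)
  have X: "X_law = density lborel (\<lambda>x. ennreal (m' x))"
  proof (rule density_cong)
    show "AE x in lborel. mix_density u0 \<sigma>0 \<epsilon> H x = ennreal (m' x)"
      using qfin
    proof eventually_elim
      case (elim x)
      then have "ennreal (enn2real (q x)) = q x" by (simp add: less_top)
      then show ?case using eps
        by (simp add: mix_density_def m'_def q_def[symmetric] case_prod_beta' ennreal_mult')
    qed
  qed (use borel_measurable_mix_density in auto)
  have "integral\<^sup>L X_law g = (\<integral>x. m' x *\<^sub>R g x \<partial>lborel)"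
    unfolding X using m'0 by (subst integral_density) auto
  also have "\<dots> = (\<integral>x. of_real (1 - \<epsilon>) * (of_real (normal_density u0 \<sigma>0 x) * g x)
      + of_real \<epsilon> * (\<integral>z. ?N z x \<partial>H) \<partial>lborel)"
    unfolding inner by (intro Bochner_Integration.integral_cong) (auto simp: m'_def scaleR_conv_of_real algebra_simps)
  also have "\<dots> = of_real (1 - \<epsilon>) * (\<integral>x. of_real (normal_density u0 \<sigma>0 x) * g x \<partial>lborel)
    + of_real \<epsilon> * (\<integral>z. (\<integral>x. ?N z x \<partial>lborel) \<partial>H)"
  proof -
    have "integrable lborel (\<lambda>x. of_real (1 - \<epsilon>) * (of_real (normal_density u0 \<sigma>0 x) * g x))"
    proof -
      have "integrable lborel (\<lambda>x. m' x *\<^sub>R g x)"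
        using int unfolding X using m'0 by (subst (asm) integrable_density) auto
      then have "integrable lborel (\<lambda>x. m' x *\<^sub>R g x - of_real \<epsilon> * (\<integral>z. ?N z x \<partial>H))"
        using i2 by (intro Bochner_Integration.integrable_diff integrable_mult_right)
      then show ?thesis
        unfolding inner by (simp add: m'_def scaleR_conv_of_real algebra_simps)
    qed
    then show ?thesis
      using i2 fub by (subst Bochner_Integration.integral_add) auto
  qed
  finally show "integral\<^sup>L X_law g = of_real (1 - \<epsilon>) * (\<integral>x. of_real (normal_density u0 \<sigma>0 x) * g x \<partial>lborel)
    + of_real \<epsilon> * (\<integral>z. (\<integral>x. ?N z x \<partial>lborel) \<partial>H)" .
qed

end

section \<open>Moments of the numerator and the denominator\<close>

context normal_contamination
begin

lemma A_nonneg: "0 \<le> A"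
  using sigma0 zero_le_power2[of \<sigma>0] by linarith

text \<open>
  Both averages studied below are of this form: \<open>p = 0\<close>, \<open>q = 1\<close> gives the summands of the generalized
  empirical characteristic function centred at \<open>u0\<close>, while \<open>p = omega\<close>,
  \<open>q = - \<i> * of_real (t * \<sigma>0\<^sup>2)\<close> gives the summands of its derivative minus \<open>\<i> * of_real (t * \<sigma>0\<^sup>2)\<close>,
  which is the logarithmic derivative for \<open>N(0, \<sigma>0\<^sup>2)\<close>, times the function itself.
\<close>

definition affine_exp :: "complex \<Rightarrow> complex \<Rightarrow> real \<Rightarrow> real \<Rightarrow> complex" where
  "affine_exp p q t x = (p * of_real (x - u0) + q) * exp (omega * of_real (t * (x - u0)))"

text \<open>The mean of \<open>exp (omega * t * (X - u0))\<close> when \<open>X\<close> is normal with the parameters \<open>z = (u, \<sigma>)\<close>.\<close>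

definition component_gcf :: "real \<Rightarrow> real \<times> real \<Rightarrow> complex" where
  "component_gcf t z = exp (omega * of_real (t * (fst z - u0)) + \<i> * of_real (t\<^sup>2 * (snd z)\<^sup>2 / 2))"

lemma borel_measurable_affine_exp [measurable]: "affine_exp p q t \<in> borel_measurable borel"
  unfolding affine_exp_def by measurable

lemma borel_measurable_component_gcf [measurable]: "component_gcf t \<in> borel_measurable H"
proof -
  have [measurable]: "fst \<in> borel_measurable H" "snd \<in> borel_measurable H"
    by measurable
  show ?thesis unfolding component_gcf_def by measurable
qed

lemma AE_scale_difference: "AE z in H. \<bar>(snd z)\<^sup>2 - \<sigma>0\<^sup>2\<bar> \<le> A"
  using AE_H
proof eventually_elim
  case (elim z)
  then show ?case
    using sigma0 zero_le_power2[of "snd z"] zero_le_power2[of \<sigma>0] by linarith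
qed

lemma norm_component_gcf: "cmod (component_gcf t z) = exp (- (t * (fst z - u0) / sqrt 2))"
  unfolding component_gcf_def exp_add norm_mult norm_exp_omega by simp

text \<open>
  A component with location \<open>u \<ge> u0\<close> contributes at most \<open>exp (t\<^sup>2 * \<sigma>\<^sup>2)\<close>, up to a polynomial in \<open>t\<close>:
  the only unbounded quantity is the square of \<open>u - u0\<close>, and the factor
  \<open>exp (- (sqrt 2 * t * (u - u0)))\<close> absorbs it. For \<open>t\<^sup>2 = \<gamma> * ln n\<close> the main factor \<open>exp (A * t\<^sup>2)\<close> is
  \<open>n\<close> to the power \<open>A * \<gamma> < 1\<close>, so averaging over \<open>n\<close> observations beats it.
\<close>

lemma second_moment_affine_exp:
  assumes t: "1 \<le> t"
  shows "(\<integral>\<^sup>+x. ennreal ((cmod (affine_exp p q t x))\<^sup>2) \<partial>X_law)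
    \<le> ennreal (exp (A * t\<^sup>2) * ((cmod p)\<^sup>2 * (4 + 2 * A + 8 * A\<^sup>2 * t\<^sup>2) + 2 * (cmod q)\<^sup>2))"
proof (rule nn_integral_X_law_le)
  show "(\<lambda>x. ennreal ((cmod (affine_exp p q t x))\<^sup>2)) \<in> borel_measurable borel" by measurable
  fix u \<sigma> :: real assume u: "u0 \<le> u" and s: "0 < \<sigma>" "\<sigma>\<^sup>2 \<le> A"
  define r where "r = sqrt 2 * t"
  have r2: "r\<^sup>2 = 2 * t\<^sup>2" by (simp add: r_def power_mult_distrib)
  let ?a = "2 * (cmod p)\<^sup>2" and ?b = "2 * (cmod q)\<^sup>2" and ?d = "u - u0"
  have pt: "(cmod (affine_exp p q t x))\<^sup>2 \<le> (?a * (x - u0)\<^sup>2 + ?b) * exp (- (r * (x - u0)))" for x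
  proof -
    have "(cmod (p * of_real (x - u0) + q))\<^sup>2 \<le> (cmod p * \<bar>x - u0\<bar> + cmod q)\<^sup>2"
      using norm_triangle_ineq[of "p * of_real (x - u0)" q]
      by (intro power_mono) (auto simp: norm_mult simp del: of_real_diff)
    also have "\<dots> \<le> 2 * (cmod p * \<bar>x - u0\<bar>)\<^sup>2 + 2 * (cmod q)\<^sup>2"
      using zero_le_power2[of "cmod p * \<bar>x - u0\<bar> - cmod q"] by (simp add: power2_eq_square algebra_simps)
    also have "\<dots> = ?a * (x - u0)\<^sup>2 + ?b" by (simp add: power_mult_distrib)
    finally have 1: "(cmod (p * of_real (x - u0) + q))\<^sup>2 \<le> ?a * (x - u0)\<^sup>2 + ?b" .
    have e: "2 * (t * (x - u0) / sqrt 2) = r * (x - u0)"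
      unfolding r_def by (simp add: field_simps)
    have "(exp (- (t * (x - u0) / sqrt 2)))\<^sup>2 = exp (- (2 * (t * (x - u0) / sqrt 2)))"
      unfolding power2_eq_square exp_add[symmetric] by simp
    then have 2: "(exp (- (t * (x - u0) / sqrt 2)))\<^sup>2 = exp (- (r * (x - u0)))"
      unfolding e .
    have "(cmod (affine_exp p q t x))\<^sup>2 = (cmod (p * of_real (x - u0) + q))\<^sup>2 * exp (- (r * (x - u0)))"
      unfolding affine_exp_def norm_mult norm_exp_omega power_mult_distrib 2 ..
    also have "\<dots> \<le> (?a * (x - u0)\<^sup>2 + ?b) * exp (- (r * (x - u0)))"
      using 1 by (rule mult_right_mono) simp
    finally show ?thesis .
  qed
  have "(\<integral>\<^sup>+x. ennreal (normal_density u \<sigma> x) * ennreal ((cmod (affine_exp p q t x))\<^sup>2) \<partial>lborel)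
    \<le> (\<integral>\<^sup>+x. ennreal (normal_density u \<sigma> x) * ennreal ((?a * (x - u0)\<^sup>2 + ?b) * exp (- (r * (x - u0)))) \<partial>lborel)"
    using pt by (intro nn_integral_mono mult_left_mono ennreal_leI) auto
  also have "\<dots> = ennreal (exp (- (r * ?d) + r\<^sup>2 * \<sigma>\<^sup>2 / 2) * (?a * ((?d - r * \<sigma>\<^sup>2)\<^sup>2 + \<sigma>\<^sup>2) + ?b))"
    by (rule nn_integral_normal_quadratic_exp[OF s(1)]) auto
  also have "\<dots> \<le> ennreal (exp (A * t\<^sup>2) * ((cmod p)\<^sup>2 * (4 + 2 * A + 8 * A\<^sup>2 * t\<^sup>2) + 2 * (cmod q)\<^sup>2))"
  proof (rule ennreal_leI)
    have d0: "0 \<le> ?d" using u by simp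
    have tr: "t \<le> r" unfolding r_def using t by simp
    then have r1: "1 \<le> r" and r0: "0 < r" using t by auto
    have e1: "exp (- (r * ?d)) \<le> 1" using d0 r1 by simp
    have "?d\<^sup>2 \<le> (r * ?d)\<^sup>2" using mult_right_mono[OF r1 d0] d0 by (intro power_mono) auto
    then have "?d\<^sup>2 * exp (- (r * ?d)) \<le> (r * ?d)\<^sup>2 * exp (- (r * ?d))" by (rule mult_right_mono) simp
    also have "\<dots> \<le> 2" using d0 r1 by (intro power2_mult_exp_neg_le_2) auto
    finally have e2: "?d\<^sup>2 * exp (- (r * ?d)) \<le> 2" .
    have s4: "(r * \<sigma>\<^sup>2)\<^sup>2 \<le> 2 * A\<^sup>2 * t\<^sup>2"
    proof -
      have "(\<sigma>\<^sup>2)\<^sup>2 \<le> A\<^sup>2" using s(2) by (intro power_mono) auto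
      then have "r\<^sup>2 * (\<sigma>\<^sup>2)\<^sup>2 \<le> r\<^sup>2 * A\<^sup>2" by (rule mult_left_mono) simp
      then show ?thesis unfolding r2 power_mult_distrib by (simp add: algebra_simps)
    qed
    have "(?d - r * \<sigma>\<^sup>2)\<^sup>2 \<le> ?d\<^sup>2 + (r * \<sigma>\<^sup>2)\<^sup>2"
      using d0 r0 by (simp add: power2_diff)
    with s4 s(2) have q: "(?d - r * \<sigma>\<^sup>2)\<^sup>2 + \<sigma>\<^sup>2 \<le> ?d\<^sup>2 + (2 * A\<^sup>2 * t\<^sup>2 + A)" by linarith
    let ?e = "exp (- (r * ?d))"
    have "exp (- (r * ?d) + r\<^sup>2 * \<sigma>\<^sup>2 / 2) = ?e * exp (t\<^sup>2 * \<sigma>\<^sup>2)"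
      unfolding exp_add[symmetric] r2 by simp
    also have "\<dots> \<le> ?e * exp (A * t\<^sup>2)"
      using mult_left_mono[OF s(2), of "t\<^sup>2"] by (simp add: mult.commute)
    finally have "exp (- (r * ?d) + r\<^sup>2 * \<sigma>\<^sup>2 / 2) * (?a * ((?d - r * \<sigma>\<^sup>2)\<^sup>2 + \<sigma>\<^sup>2) + ?b)
      \<le> (?e * exp (A * t\<^sup>2)) * (?a * (?d\<^sup>2 + (2 * A\<^sup>2 * t\<^sup>2 + A)) + ?b)"
      using q by (intro mult_mono add_right_mono mult_left_mono) auto
    also have "\<dots> = exp (A * t\<^sup>2) * (?a * (?d\<^sup>2 * ?e + (2 * A\<^sup>2 * t\<^sup>2 + A) * ?e) + ?b * ?e)"
      by (simp add: algebra_simps)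
    also have "\<dots> \<le> exp (A * t\<^sup>2) * (?a * (2 + (2 * A\<^sup>2 * t\<^sup>2 + A) * 1) + ?b * 1)"
      using e1 e2 A_nonneg by (intro mult_left_mono add_mono) auto
    also have "\<dots> \<le> exp (A * t\<^sup>2) * ((cmod p)\<^sup>2 * (4 + 2 * A + 8 * A\<^sup>2 * t\<^sup>2) + 2 * (cmod q)\<^sup>2)"
    proof (rule mult_left_mono)
      have "0 \<le> (cmod p)\<^sup>2 * (A\<^sup>2 * t\<^sup>2)" by simp
      then show "?a * (2 + (2 * A\<^sup>2 * t\<^sup>2 + A) * 1) + ?b * 1 \<le> (cmod p)\<^sup>2 * (4 + 2 * A + 8 * A\<^sup>2 * t\<^sup>2) + 2 * (cmod q)\<^sup>2"
        by (simp add: algebra_simps)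
    qed simp
    finally show "exp (- (r * ?d) + r\<^sup>2 * \<sigma>\<^sup>2 / 2) * (?a * ((?d - r * \<sigma>\<^sup>2)\<^sup>2 + \<sigma>\<^sup>2) + ?b)
      \<le> exp (A * t\<^sup>2) * ((cmod p)\<^sup>2 * (4 + 2 * A + 8 * A\<^sup>2 * t\<^sup>2) + 2 * (cmod q)\<^sup>2)" .
  qed
  finally show "(\<integral>\<^sup>+x. ennreal (normal_density u \<sigma> x) * ennreal ((cmod (affine_exp p q t x))\<^sup>2) \<partial>lborel)
    \<le> ennreal (exp (A * t\<^sup>2) * ((cmod p)\<^sup>2 * (4 + 2 * A + 8 * A\<^sup>2 * t\<^sup>2) + 2 * (cmod q)\<^sup>2))" .
qed

lemma integral_affine_exp:
  assumes int: "integrable X_law (affine_exp p q t)"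
  shows "integral\<^sup>L X_law (affine_exp p q t) =
    of_real (1 - \<epsilon>) * ((p * (omega * of_real (t * \<sigma>0\<^sup>2)) + q) * exp (\<i> * of_real (t\<^sup>2 * \<sigma>0\<^sup>2 / 2)))
    + of_real \<epsilon> * (\<integral>z. (p * (of_real (fst z - u0) + omega * of_real (t * (snd z)\<^sup>2)) + q) * component_gcf t z \<partial>H)"
proof -
  have 1: "(\<integral>x. of_real (normal_density u0 \<sigma>0 x) * affine_exp p q t x \<partial>lborel)
    = (p * (omega * of_real (t * \<sigma>0\<^sup>2)) + q) * exp (\<i> * of_real (t\<^sup>2 * \<sigma>0\<^sup>2 / 2))"
    unfolding affine_exp_def integral_normal_affine_exp[OF sigma0(1)] by simp
  have "(\<integral>z. (\<integral>x. of_real (normal_density (fst z) (snd z) x) * affine_exp p q t x \<partial>lborel) \<partial>H)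
    = (\<integral>z. (p * (of_real (fst z - u0) + omega * of_real (t * (snd z)\<^sup>2)) + q) * component_gcf t z \<partial>H)"
  proof (rule integral_cong_AE)
    show "(\<lambda>z. \<integral>x. of_real (normal_density (fst z) (snd z) x) * affine_exp p q t x \<partial>lborel) \<in> borel_measurable H"
      using integral_X_law(2)[OF int] eps by auto
    show "(\<lambda>z. (p * (of_real (fst z - u0) + omega * of_real (t * (snd z)\<^sup>2)) + q) * component_gcf t z) \<in> borel_measurable H"
      by measurable
    show "AE z in H. (\<integral>x. of_real (normal_density (fst z) (snd z) x) * affine_exp p q t x \<partial>lborel)
      = (p * (of_real (fst z - u0) + omega * of_real (t * (snd z)\<^sup>2)) + q) * component_gcf t z"
      using AE_H
    proof eventually_elim
      case (elim z)
      then have "0 < snd z" by simp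
      then show ?case unfolding affine_exp_def component_gcf_def by (rule integral_normal_affine_exp)
    qed
  qed
  with 1 show ?thesis
    using integral_X_law(1)[OF int] by simp
qed

text \<open>
  The main component has modulus \<open>1 - \<epsilon>\<close>; the contamination has modulus at most \<open>\<epsilon>\<close> because every
  location in it lies to the right of \<open>u0\<close>. Hence \<open>\<epsilon> < 1 / 2\<close> keeps the denominator away from zero.
\<close>

lemma norm_mean_denominator_ge:
  assumes t: "0 \<le> t" and int: "integrable X_law (affine_exp 0 1 t)"
  shows "1 - 2 * \<epsilon> \<le> cmod (integral\<^sup>L X_law (affine_exp 0 1 t))"
proof -
  let ?a = "of_real (1 - \<epsilon>) * exp (\<i> * of_real (t\<^sup>2 * \<sigma>0\<^sup>2 / 2))" and ?b = "of_real \<epsilon> * (\<integral>z. component_gcf t z \<partial>H)"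
  have eq: "integral\<^sup>L X_law (affine_exp 0 1 t) = ?a + ?b"
    unfolding integral_affine_exp[OF int] by simp
  have "cmod (\<integral>z. component_gcf t z \<partial>H) \<le> 1"
    by (rule H.norm_integral_le_const) (use AE_H t in \<open>auto simp: norm_component_gcf elim!: eventually_mono\<close>)
  then have b: "cmod ?b \<le> \<epsilon>" using eps by (simp add: norm_mult mult_left_le)
  have a: "cmod ?a = 1 - \<epsilon>" using eps unfolding norm_mult norm_exp_i_times norm_of_real by simp
  show ?thesis unfolding eq using norm_diff_ineq[of ?a ?b] a b by linarith
qed

text \<open>The part of the bias caused by contaminating scales that differ from \<open>\<sigma>0\<close>.\<close>

definition scale_bias :: "real \<Rightarrow> complex" where
  "scale_bias t = (\<integral>z. of_real ((snd z)\<^sup>2 - \<sigma>0\<^sup>2) * component_gcf t z \<partial>H)"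

text \<open>
  By \<open>omega\<^sup>2 = \<i>\<close> the contribution of the main component cancels, and only the contamination remains.
  Its location part \<open>(u - u0) * exp (- (t * (u - u0) / sqrt 2))\<close> is \<open>O(1 / t)\<close> whatever \<open>H\<close> is; its scale
  part needs the additional assumptions on the class.
\<close>

lemma norm_mean_numerator_le:
  assumes t: "0 < t" and int: "integrable X_law (affine_exp omega (- \<i> * of_real (t * \<sigma>0\<^sup>2)) t)"
  shows "cmod (integral\<^sup>L X_law (affine_exp omega (- \<i> * of_real (t * \<sigma>0\<^sup>2)) t))
    \<le> sqrt 2 / t + \<epsilon> * t * cmod (scale_bias t)"
proof -
  have AE_component_gcf: "AE z in H. cmod (component_gcf t z) \<le> 1"
    using AE_H t by (auto simp: norm_component_gcf elim!: eventually_mono)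
  have AE1: "AE z in H. cmod (omega * of_real (fst z - u0) * component_gcf t z) \<le> sqrt 2 / t"
    using AE_H
  proof eventually_elim
    case (elim z)
    let ?y = "t * (fst z - u0) / sqrt 2"
    have "cmod (omega * of_real (fst z - u0) * component_gcf t z) = (sqrt 2 / t) * (?y * exp (- ?y))"
      using elim t unfolding norm_mult norm_omega norm_component_gcf norm_of_real by simp
    also have "\<dots> \<le> sqrt 2 / t * 1"
      using t by (intro mult_left_mono mult_exp_neg_le_1) auto
    finally show ?case by simp
  qed
  have AE2: "AE z in H. cmod (of_real ((snd z)\<^sup>2 - \<sigma>0\<^sup>2) * component_gcf t z) \<le> A"
    using AE_scale_difference AE_component_gcf
  proof eventually_elim
    case (elim z)
    then have "\<bar>(snd z)\<^sup>2 - \<sigma>0\<^sup>2\<bar> * cmod (component_gcf t z) \<le> A * 1"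
      using elim A_nonneg by (intro mult_mono) auto
    then show ?case unfolding norm_mult norm_of_real by simp
  qed
  have i1: "integrable H (\<lambda>z. omega * of_real (fst z - u0) * component_gcf t z)"
    by (rule H.integrable_const_bound[OF AE1]) measurable
  have i2: "integrable H (\<lambda>z. of_real ((snd z)\<^sup>2 - \<sigma>0\<^sup>2) * component_gcf t z)"
    by (rule H.integrable_const_bound[OF AE2]) measurable
  have w: "omega * (omega * c) = \<i> * c" for c
    unfolding mult.assoc[symmetric] power2_eq_square[symmetric] omega_squared ..
  have main: "omega * (omega * of_real (t * \<sigma>0\<^sup>2)) + - \<i> * of_real (t * \<sigma>0\<^sup>2) = 0"
    unfolding w by simp
  have integrand: "(omega * (of_real (fst z - u0) + omega * of_real (t * (snd z)\<^sup>2)) + - \<i> * of_real (t * \<sigma>0\<^sup>2)) * component_gcf t z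
    = omega * of_real (fst z - u0) * component_gcf t z + \<i> * of_real t * (of_real ((snd z)\<^sup>2 - \<sigma>0\<^sup>2) * component_gcf t z)" for z
    unfolding distrib_left w by (simp add: algebra_simps)
  have "integral\<^sup>L X_law (affine_exp omega (- \<i> * of_real (t * \<sigma>0\<^sup>2)) t)
    = of_real \<epsilon> * ((\<integral>z. omega * of_real (fst z - u0) * component_gcf t z \<partial>H) + \<i> * of_real t * scale_bias t)"
    unfolding integral_affine_exp[OF int] main integrand scale_bias_def
    by (subst Bochner_Integration.integral_add[OF i1 integrable_mult_right[OF i2]])
       (simp only: integral_mult_right_zero mult_zero_left mult_zero_right add_0_left)
  also have "cmod \<dots> \<le> \<epsilon> * (cmod (\<integral>z. omega * of_real (fst z - u0) * component_gcf t z \<partial>H) + t * cmod (scale_bias t))"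
  proof -
    have "cmod ((\<integral>z. omega * of_real (fst z - u0) * component_gcf t z \<partial>H) + \<i> * of_real t * scale_bias t)
      \<le> cmod (\<integral>z. omega * of_real (fst z - u0) * component_gcf t z \<partial>H) + t * cmod (scale_bias t)"
      using t by (intro order_trans[OF norm_triangle_ineq]) (simp add: norm_mult)
    then show ?thesis using eps unfolding norm_mult norm_of_real by (simp add: mult_left_mono)
  qed
  also have "\<dots> \<le> \<epsilon> * (sqrt 2 / t + t * cmod (scale_bias t))"
    using eps t by (intro mult_left_mono add_right_mono H.norm_integral_le_const[OF AE1]) auto
  also have "\<dots> \<le> sqrt 2 / t + \<epsilon> * t * cmod (scale_bias t)"
    using eps t mult_right_mono[of \<epsilon> 1 "sqrt 2 / t"] by (simp add: distrib_left)
  finally show ?thesis .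
qed

text \<open>With \<open>d = 0\<close> this is the trivial bound \<open>A\<close>; separated locations give exponential decay.\<close>

lemma norm_scale_bias_le:
  assumes t: "0 \<le> t" and d: "AE z in H. d \<le> fst z - u0"
  shows "cmod (scale_bias t) \<le> A * exp (- (t * d / sqrt 2))"
  unfolding scale_bias_def
proof (rule H.norm_integral_le_const)
  show "AE z in H. cmod (of_real ((snd z)\<^sup>2 - \<sigma>0\<^sup>2) * component_gcf t z) \<le> A * exp (- (t * d / sqrt 2))"
    using AE_scale_difference d
  proof eventually_elim
    case (elim z)
    have "exp (- (t * (fst z - u0) / sqrt 2)) \<le> exp (- (t * d / sqrt 2))"
      using elim t by (simp add: divide_right_mono mult_left_mono)
    then show ?case
      unfolding norm_mult norm_of_real norm_component_gcf using elim A_nonneg by (intro mult_mono) auto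
  qed
qed (use A_nonneg in simp)

end

section \<open>The scale bias under smooth mixing\<close>

text \<open>
  Up to the factor \<open>\<i>\<close>, the oscillating first moment of a probability density is the derivative of its
  Fourier transform. Stating this for the unnormalised density \<open>P\<close>, with \<open>m\<close> on the right, includes
  the case of zero mass.
\<close>

lemma norm_first_moment_Fourier_le:
  fixes P :: "real \<Rightarrow> real"
  assumes P0: "\<And>x. 0 \<le> P x" and P: "integrable lborel P" and P2: "integrable lborel (\<lambda>x. x\<^sup>2 * P x)"
    and m: "m = integral\<^sup>L lborel P"
    and D: "0 < m \<Longrightarrow> cmod (vector_derivative (\<lambda>s. \<integral>x. iexp (s * x) * complex_of_real (P x / m) \<partial>lborel) (at s)) \<le> D"
  shows "cmod (\<integral>x. of_real x * iexp (s * x) * complex_of_real (P x) \<partial>lborel) \<le> D * m"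
proof (cases "0 < m")
  case True
  have "((\<lambda>s. \<integral>x. iexp (s * x) * complex_of_real (P x / m) \<partial>lborel) has_vector_derivative
      (\<integral>x. \<i> * of_real x * iexp (s * x) * complex_of_real (P x / m) \<partial>lborel)) (at s)"
    using P0 P P2 True by (intro has_vector_derivative_Fourier) simp_all
  from vector_derivative_at[OF this] D[OF True]
  have "cmod (\<integral>x. \<i> * of_real x * iexp (s * x) * complex_of_real (P x / m) \<partial>lborel) \<le> D" by simp
  also have "(\<lambda>x. \<i> * of_real x * iexp (s * x) * complex_of_real (P x / m))
     = (\<lambda>x. (\<i> / of_real m) * (of_real x * iexp (s * x) * complex_of_real (P x)))"
    by (simp add: fun_eq_iff)
  finally have "cmod (\<integral>x. of_real x * iexp (s * x) * complex_of_real (P x) \<partial>lborel) / m \<le> D"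
    using True unfolding integral_mult_right_zero norm_mult norm_divide by simp
  then show ?thesis using True by (simp add: field_simps)
next
  case False
  moreover have "0 \<le> m" unfolding m using P0 by simp
  ultimately have "integral\<^sup>L lborel P = 0" using m by simp
  then have "AE x in lborel. P x = 0"
    using integral_nonneg_eq_0_iff_AE[OF P] P0 by simp
  then have "(\<integral>x. of_real x * iexp (s * x) * complex_of_real (P x) \<partial>lborel) = (\<integral>x. 0 \<partial>(lborel :: real measure))"
    using P by (intro integral_cong_AE) (auto elim!: eventually_mono)
  with False \<open>0 \<le> m\<close> show ?thesis by simp
qed

context normal_contamination
begin

text \<open>
  Writing \<open>\<delta> = u - u0\<close> and \<open>\<kappa> = (\<sigma>\<^sup>2 - \<sigma>0\<^sup>2) / 2\<close>, the scale bias is, up to a phase, the integral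
  over \<open>\<delta>\<close> of \<open>exp (omega * t * \<delta>)\<close> times the integral of \<open>2 * \<kappa> * exp (\<i> * t\<^sup>2 * \<kappa>)\<close> against
  the joint density. For fixed \<open>\<delta>\<close> the latter is the marginal density times twice the
  derivative of the conditional Fourier transform at \<open>t\<^sup>2\<close>, which has order
  \<open>t\<^sup>2\<close> to the power \<open>- (\<alpha> + 1)\<close>. Since \<open>\<kappa>\<close> is bounded almost surely, almost every conditional density
  has a second moment, so that differentiation under the integral is legitimate.
\<close>

lemma norm_scale_bias_le_FT:
  assumes t: "0 \<le> t" and FT: "FT_bounds \<alpha> C u0 \<sigma>0 H"
  shows "cmod (scale_bias t) \<le> 2 * (C * (1 + t\<^sup>2) powr (- (\<alpha> + 1)))"
proof -
  let ?L = "lborel \<Otimes>\<^sub>M lborel :: (real \<times> real) measure"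
  define \<Phi> where "\<Phi> = (\<lambda>(u, \<sigma>). (u - u0, (\<sigma>\<^sup>2 - \<sigma>0\<^sup>2) / 2))"
  define D where "D = C * (1 + t\<^sup>2) powr (- (\<alpha> + 1))"
  obtain p where p0: "\<And>z. 0 \<le> p z" and dist: "distributed H ?L \<Phi> (\<lambda>z. ennreal (p z))"
    and der: "\<And>\<delta>. marginal p \<delta> > 0 \<Longrightarrow> cmod (vector_derivative (cond_FT p \<delta>) (at (t\<^sup>2))) \<le> D"
    using FT unfolding FT_bounds_def \<Phi>_def[symmetric] D_def by (metis abs_of_nonneg zero_le_power2)
  have pm [measurable]: "p \<in> borel_measurable ?L"
    using distributed_real_measurable[OF _ dist] p0 by simp
  have \<Phi>m [measurable]: "\<Phi> \<in> measurable H ?L" using dist by (simp add: distributed_def)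
  have law: "distr H ?L \<Phi> = density ?L (\<lambda>z. ennreal (p z))"
    using dist by (simp add: distributed_def)
  have "integrable (distr H ?L \<Phi>) (\<lambda>_. 1 :: real)"
    by (subst integrable_distr_eq) auto
  then have pint: "integrable ?L p"
    unfolding law using p0 by (subst (asm) integrable_density) auto
  have "(\<integral>z. 1 \<partial>distr H ?L \<Phi>) = (1::real)"
    by (subst integral_distr) (auto simp: H.prob_space)
  then have p1: "integral\<^sup>L ?L p = 1"
    unfolding law using p0 by (subst (asm) integral_density) auto
  have "AE y in distr H ?L \<Phi>. 0 < fst y \<and> \<bar>snd y\<bar> \<le> A"
  proof (subst AE_distr_iff[OF \<Phi>m])
    show "AE z in H. 0 < fst (\<Phi> z) \<and> \<bar>snd (\<Phi> z)\<bar> \<le> A"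
      using AE_H AE_scale_difference
    proof eventually_elim
      case (elim z)
      then have "(snd z)\<^sup>2 - \<sigma>0\<^sup>2 \<le> A * 2" "\<sigma>0\<^sup>2 - (snd z)\<^sup>2 \<le> A * 2"
        using A_nonneg by linarith+
      then show ?case
        using elim by (simp add: \<Phi>_def case_prod_beta' abs_le_iff)
    qed
  qed measurable
  then have "AE y in ?L. 0 < p y \<longrightarrow> 0 < fst y \<and> \<bar>snd y\<bar> \<le> A"
    unfolding law by (subst (asm) AE_density) auto
  then have supp: "AE \<delta> in lborel. AE \<kappa> in lborel. 0 < p (\<delta>, \<kappa>) \<longrightarrow> 0 < \<delta> \<and> \<bar>\<kappa>\<bar> \<le> A"
    using lborel_pair.AE_pair[of "\<lambda>y. 0 < p y \<longrightarrow> 0 < fst y \<and> \<bar>snd y\<bar> \<le> A"] by simp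
  have sect: "AE \<delta> in lborel. integrable lborel (\<lambda>\<kappa>. p (\<delta>, \<kappa>))"
    using lborel_pair.AE_integrable_fst'[OF pint] by simp
  define g where "g y = 2 * of_real (snd y) * exp (omega * of_real (t * fst y) + \<i> * of_real (t\<^sup>2 * (snd y + \<sigma>0\<^sup>2 / 2)))" for y :: "real \<times> real"
  have gm [measurable]: "g \<in> borel_measurable ?L" unfolding g_def by measurable
  have gi: "integrable H (\<lambda>z. g (\<Phi> z))"
    and gI: "scale_bias t = (\<integral>z. g (\<Phi> z) \<partial>H)"
  proof -
    have eq: "g (\<Phi> z) = of_real ((snd z)\<^sup>2 - \<sigma>0\<^sup>2) * component_gcf t z" for z
      by (simp add: g_def \<Phi>_def component_gcf_def case_prod_beta' diff_divide_distrib)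
    show "scale_bias t = (\<integral>z. g (\<Phi> z) \<partial>H)" unfolding eq scale_bias_def ..
    have "AE z in H. cmod (g (\<Phi> z)) \<le> A"
      unfolding eq using AE_H AE_scale_difference
    proof eventually_elim
      case (elim z)
      have "exp (- (t * (fst z - u0) / sqrt 2)) \<le> 1" using elim t by simp
      then have "\<bar>(snd z)\<^sup>2 - \<sigma>0\<^sup>2\<bar> * exp (- (t * (fst z - u0) / sqrt 2)) \<le> A * 1"
        using elim A_nonneg by (intro mult_mono) auto
      then show ?case unfolding norm_mult norm_of_real norm_component_gcf by simp
    qed
    then show "integrable H (\<lambda>z. g (\<Phi> z))"
      by (rule H.integrable_const_bound) measurable
  qed
  have "integrable (distr H ?L \<Phi>) g" using gi by (subst integrable_distr_eq) auto
  then have gpi: "integrable ?L (\<lambda>y. p y *\<^sub>R g y)"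
    unfolding law using p0 by (subst (asm) integrable_density) auto
  have "scale_bias t = integral\<^sup>L (distr H ?L \<Phi>) g"
    unfolding gI by (subst integral_distr) auto
  also have "\<dots> = (\<integral>y. p y *\<^sub>R g y \<partial>?L)"
    unfolding law using p0 by (subst integral_density) auto
  also have "\<dots> = (\<integral>\<delta>. (\<integral>\<kappa>. p (\<delta>, \<kappa>) *\<^sub>R g (\<delta>, \<kappa>) \<partial>lborel) \<partial>lborel)"
    using lborel_pair.integral_fst'[OF gpi] by simp
  finally have bias: "scale_bias t = (\<integral>\<delta>. (\<integral>\<kappa>. p (\<delta>, \<kappa>) *\<^sub>R g (\<delta>, \<kappa>) \<partial>lborel) \<partial>lborel)" .
  have inner: "AE \<delta> in lborel. cmod (\<integral>\<kappa>. p (\<delta>, \<kappa>) *\<^sub>R g (\<delta>, \<kappa>) \<partial>lborel) \<le> 2 * D * marginal p \<delta>"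
    using supp sect
  proof eventually_elim
    case (elim \<delta>)
    define P where "P \<kappa> = p (\<delta>, \<kappa>)" for \<kappa>
    have P: "integrable lborel P" and P0: "\<And>\<kappa>. 0 \<le> P \<kappa>" using elim(2) p0 by (simp_all add: P_def [abs_def])
    have [measurable]: "P \<in> borel_measurable borel" using P by auto
    have m: "marginal p \<delta> = integral\<^sup>L lborel P" by (simp add: marginal_def P_def [abs_def])
    (* Where \<delta> is not positive the section vanishes almost everywhere; elsewhere |exp (omega * t * \<delta>)| is at most 1. *)
    show ?case
    proof (cases "0 < \<delta>")
      case False
      have "AE \<kappa> in lborel. P \<kappa> = 0"
        using elim(1) False P0 by (auto simp: P_def less_le elim!: eventually_mono)
      then have "(\<integral>\<kappa>. P \<kappa> *\<^sub>R g (\<delta>, \<kappa>) \<partial>lborel) = (\<integral>\<kappa>. 0 \<partial>(lborel :: real measure))"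
        and "integral\<^sup>L lborel P = (\<integral>\<kappa>. 0 \<partial>(lborel :: real measure))"
        by (intro integral_cong_AE; auto simp: g_def elim!: eventually_mono)+
      then show ?thesis unfolding m by (simp add: P_def)
    next
      case True
      have P2: "integrable lborel (\<lambda>\<kappa>. \<kappa>\<^sup>2 * P \<kappa>)"
      proof (rule Bochner_Integration.integrable_bound[where f = "\<lambda>\<kappa>. A\<^sup>2 * P \<kappa>"])
        show "integrable lborel (\<lambda>\<kappa>. A\<^sup>2 * P \<kappa>)" using P by simp
        show "AE \<kappa> in lborel. norm (\<kappa>\<^sup>2 * P \<kappa>) \<le> norm (A\<^sup>2 * P \<kappa>)"
          using elim(1)
        proof eventually_elim
          case (elim \<kappa>)
          show ?case
          proof (cases "0 < P \<kappa>")
            case True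
            then have "\<bar>\<kappa>\<bar> \<le> A" using elim by (simp add: P_def)
            then have "\<bar>\<kappa>\<bar>\<^sup>2 \<le> A\<^sup>2" by (intro power_mono) auto
            then show ?thesis using P0[of \<kappa>] by (simp add: abs_mult mult_right_mono)
          next
            case False
            then have "P \<kappa> = 0" using P0[of \<kappa>] by simp
            then show ?thesis by simp
          qed
        qed
      qed measurable
      define B where "B = 2 * exp (omega * of_real (t * \<delta>) + \<i> * of_real (t\<^sup>2 * (\<sigma>0\<^sup>2 / 2)))"
      have "P \<kappa> *\<^sub>R g (\<delta>, \<kappa>) = B * (of_real \<kappa> * iexp (t\<^sup>2 * \<kappa>) * of_real (P \<kappa>))" for \<kappa>
        unfolding g_def B_def by (simp add: exp_add scaleR_conv_of_real distrib_left)
      then have eq: "(\<integral>\<kappa>. p (\<delta>, \<kappa>) *\<^sub>R g (\<delta>, \<kappa>) \<partial>lborel) = B * (\<integral>\<kappa>. of_real \<kappa> * iexp (t\<^sup>2 * \<kappa>) * of_real (P \<kappa>) \<partial>lborel)"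
        by (simp only: P_def[symmetric] integral_mult_right_zero)
      have nB: "cmod B \<le> 2"
        using True t unfolding B_def exp_add norm_mult norm_exp_omega norm_exp_i_times by simp
      have "cmod (\<integral>\<kappa>. of_real \<kappa> * iexp (t\<^sup>2 * \<kappa>) * of_real (P \<kappa>) \<partial>lborel) \<le> D * marginal p \<delta>"
      proof (rule norm_first_moment_Fourier_le[OF P0 P P2 m])
        assume "0 < marginal p \<delta>"
        from der[OF this] show "cmod (vector_derivative (\<lambda>s. \<integral>x. iexp (s * x) * complex_of_real (P x / marginal p \<delta>) \<partial>lborel) (at (t\<^sup>2))) \<le> D"
          unfolding cond_FT_def [abs_def] cond_density_def P_def .
      qed
      then have "cmod B * cmod (\<integral>\<kappa>. of_real \<kappa> * iexp (t\<^sup>2 * \<kappa>) * of_real (P \<kappa>) \<partial>lborel) \<le> 2 * (D * marginal p \<delta>)"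
        using nB by (intro mult_mono) auto
      then show ?thesis unfolding eq norm_mult by simp
    qed
  qed
  have mi: "integrable lborel (marginal p)"
    using lborel_pair.integrable_fst'[OF pint] by (simp add: marginal_def [abs_def])
  have "cmod (scale_bias t) \<le> (\<integral>\<delta>. cmod (\<integral>\<kappa>. p (\<delta>, \<kappa>) *\<^sub>R g (\<delta>, \<kappa>) \<partial>lborel) \<partial>lborel)"
    unfolding bias by (rule integral_norm_bound)
  also have "\<dots> \<le> (\<integral>\<delta>. 2 * D * marginal p \<delta> \<partial>lborel)"
    using lborel_pair.integrable_fst'[OF gpi] mi inner by (intro integral_mono_AE) auto
  also have "\<dots> = 2 * D * integral\<^sup>L lborel (marginal p)" by (rule integral_mult_right_zero)
  also have "integral\<^sup>L lborel (marginal p) = 1"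
    using lborel_pair.integral_fst'[OF pint] p1 by (simp add: marginal_def [abs_def])
  finally show ?thesis by (simp add: D_def)
qed

end

section \<open>The estimators as functions of the logarithmic derivative\<close>

lemma u0_fun_eq:
  assumes g: "(g has_vector_derivative g') (at t)" and nz: "g t \<noteq> 0"
  shows "u0_fun g t = - sqrt 2 * Re (g' / g t)"
proof -
  have "((\<lambda>s. norm (g s)) has_derivative (\<lambda>h. (h *\<^sub>R g') \<bullet> sgn (g t))) (at t)"
    using has_derivative_compose[OF g[unfolded has_vector_derivative_def] has_derivative_norm[OF nz]]
    by (simp add: inner_commute)
  then have "((\<lambda>s. cmod (g s)) has_real_derivative (g' \<bullet> sgn (g t))) (at t)"
    by (simp add: has_field_derivative_def mult.commute[of _ "_ \<bullet> _"])
  then have "deriv (\<lambda>s. cmod (g s)) t = g' \<bullet> sgn (g t)"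
    by (rule DERIV_imp_deriv)
  moreover have "g' \<bullet> sgn (g t) = Re (g' * cnj (g t)) / cmod (g t)"
    by (simp add: inner_complex_def sgn_div_norm divide_inverse algebra_simps)
  moreover have "Re (g' / g t) = Re (g' * cnj (g t)) / (cmod (g t))\<^sup>2"
  proof -
    have "g' / g t = g' * cnj (g t) / of_real ((cmod (g t))\<^sup>2)"
      by (simp only: complex_div_cnj[of g' "g t"] of_real_power)
    then show ?thesis by (simp only: Re_divide_of_real)
  qed
  ultimately show ?thesis
    by (simp add: u0_fun_def power2_eq_square)
qed

lemma sigma0_sq_fun_eq:
  assumes g: "(g has_vector_derivative g') (at t)" and nz: "g t \<noteq> 0"
  shows "sigma0_sq_fun g t = sqrt 2 / t * Re (omega * (g' / g t))"
proof -
  have "omega * (g' / g t) = omega * cnj (g t) * g' / of_real ((cmod (g t))\<^sup>2)"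
    by (simp only: complex_div_cnj[of g' "g t"] of_real_power times_divide_eq_right mult_ac)
  then have "Re (omega * (g' / g t)) = Re (omega * cnj (g t) * g') / (cmod (g t))\<^sup>2"
    by (simp only: Re_divide_of_real)
  then show ?thesis
    using vector_derivative_at[OF g] by (simp add: sigma0_sq_fun_def)
qed

lemma has_vector_derivative_gecf:
  "(gecf n x has_vector_derivative
     (\<Sum>j=1..n. omega * of_real (x j) * exp (omega * of_real (t * x j))) / of_nat n) (at t)"
proof -
  have "((\<lambda>s. exp (omega * of_real (s * x j))) has_vector_derivative
      omega * of_real (x j) * exp (omega * of_real (t * x j))) (at t)" for j
  proof -
    have "((\<lambda>z. exp (omega * (z * of_real (x j)))) has_field_derivative
        omega * of_real (x j) * exp (omega * (of_real t * of_real (x j)))) (at (of_real t))"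
      by (auto intro!: derivative_eq_intros)
    from has_vector_derivative_real_field[OF this] show ?thesis by simp
  qed
  then have "((\<lambda>s. \<Sum>j=1..n. exp (omega * of_real (s * x j))) has_vector_derivative
      (\<Sum>j=1..n. omega * of_real (x j) * exp (omega * of_real (t * x j)))) (at t)"
    by (rule has_vector_derivative_sum)
  then show ?thesis
    unfolding gecf_def [abs_def] by (rule has_vector_derivative_divide)
qed

text \<open>
  Both functionals are linear in the logarithmic derivative of the generalized empirical characteristic
  function. Centring the data at \<open>u0\<close> lowers it by \<open>omega * u0\<close>, and subtracting the normal value
  \<open>\<i> * t * \<sigma>0\<^sup>2\<close> as well leaves the quotient \<open>Z / W\<close> of two averages. The real parts of \<open>omega\<close> and of
  \<open>omega * \<i>\<close> make the first functional read off \<open>u0\<close>, and \<open>omega\<^sup>2 = \<i>\<close> makes the second one blind to it.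
\<close>

lemma estimator_errors:
  fixes x :: "nat \<Rightarrow> real" and u0 \<sigma>0 :: real
  assumes t: "0 < t" and n: "0 < n"
  defines "W \<equiv> (\<Sum>j=1..n. exp (omega * of_real (t * (x j - u0)))) / of_nat n"
    and "Z \<equiv> (\<Sum>j=1..n. (omega * of_real (x j - u0) + (- \<i> * of_real (t * \<sigma>0\<^sup>2))) * exp (omega * of_real (t * (x j - u0)))) / of_nat n"
  assumes W: "W \<noteq> 0"
  shows "u0_est d n t x - u0 = - sqrt 2 * Re (Z / W)"
    and "sigma0_sq_est d n t x - \<sigma>0\<^sup>2 = sqrt 2 / t * Re (omega * (Z / W))"
proof -
  define E where "E = exp (omega * of_real (t * u0))"
  define g' where "g' = (\<Sum>j=1..n. omega * of_real (x j) * exp (omega * of_real (t * x j))) / of_nat n"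
  have e: "exp (omega * of_real (t * x j)) = E * exp (omega * of_real (t * (x j - u0)))" for j
    unfolding E_def exp_add[symmetric] by (simp add: algebra_simps)
  have g: "gecf n x t = E * W"
    unfolding gecf_def W_def e by (simp only: sum_distrib_left times_divide_eq_right)
  have g': "g' = E * (Z + (omega * of_real u0 + \<i> * of_real (t * \<sigma>0\<^sup>2)) * W)"
    unfolding g'_def W_def Z_def e sum_distrib_left times_divide_eq_right add_divide_distrib[symmetric] sum.distrib[symmetric]
    by (intro arg_cong2[where f="(/)"] sum.cong refl) (simp add: algebra_simps)
  have E0: "E \<noteq> 0" unfolding E_def by simp
  have nz: "gecf n x t \<noteq> 0" unfolding g using W E0 by simp
  have q: "g' / gecf n x t = omega * of_real u0 + \<i> * of_real (t * \<sigma>0\<^sup>2) + Z / W"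
    unfolding g g' using W E0 by (simp add: field_simps)
  note D = has_vector_derivative_gecf[of n x t, folded g'_def]
  have Re_omega: "Re omega = - 1 / sqrt 2" "Re (omega * \<i>) = 1 / sqrt 2"
    by (simp_all add: omega_def Re_divide_of_real Im_divide_of_real)
  have 1: "Re (g' / gecf n x t) = - u0 / sqrt 2 + Re (Z / W)"
    unfolding q using Re_omega by simp
  have "omega * (g' / gecf n x t) = (omega * omega) * of_real u0 + omega * \<i> * of_real (t * \<sigma>0\<^sup>2) + omega * (Z / W)"
    unfolding q by (simp add: algebra_simps)
  then have 2: "Re (omega * (g' / gecf n x t)) = t * \<sigma>0\<^sup>2 / sqrt 2 + Re (omega * (Z / W))"
    using Re_omega omega_squared by (simp add: power2_eq_square)
  show "u0_est d n t x - u0 = - sqrt 2 * Re (Z / W)"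
    unfolding u0_est_def u0_fun_eq[OF D nz] 1 using nz by (simp add: algebra_simps)
  show "sigma0_sq_est d n t x - \<sigma>0\<^sup>2 = sqrt 2 / t * Re (omega * (Z / W))"
    unfolding sigma0_sq_est_def sigma0_sq_fun_eq[OF D nz] 2 using nz t by (simp add: algebra_simps)
qed

section \<open>Uniform consistency\<close>

lemma normal_contamination_Lambda:
  assumes "(u0, \<sigma>0, \<epsilon>, H) \<in> Lambda \<epsilon>0 A" "\<epsilon>0 \<le> 1"
  shows "normal_contamination u0 \<sigma>0 \<epsilon> A H"
proof -
  from assms have s: "0 < \<sigma>0" "\<sigma>0\<^sup>2 \<le> A" and e: "0 < \<epsilon>" "\<epsilon> \<le> \<epsilon>0"
      and H: "prob_space H" and sH: "sets H = sets borel"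
      and m: "measure H {(u, \<sigma>). 0 < \<sigma>} = 1" "measure H {(u, \<sigma>). u0 < u} = 1"
        "measure H {(u, \<sigma>). \<sigma>\<^sup>2 \<le> A} = 1"
    unfolding Lambda_def by simp_all
  have AE: "AE z in H. u0 < fst z \<and> 0 < snd z \<and> (snd z)\<^sup>2 \<le> A"
    using m[THEN prob_space.AE_prob_1[OF H]] by (auto simp: case_prod_beta')
  show ?thesis
    by (rule normal_contamination.intro[OF s e(1) order_trans[OF e(2) assms(2)] H sH AE])
qed

context normal_contamination
begin

text \<open>
  With probability at least \<open>1 - b\<close> both averages are close to their means, by Chebyshev's inequality.
  Then the denominator exceeds \<open>c / 2\<close> and the numerator stays below \<open>\<theta>\<close>, half of which is
  reserved for its mean. The value \<open>\<theta> = \<eta> * c / 4\<close> makes the quotient at most \<open>\<eta> / 2\<close>, which leaves room for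
  the factor \<open>sqrt 2\<close>.
\<close>

lemma estimator_deviation:
  assumes n: "0 < n" and t: "1 \<le> t" and \<eta>: "0 < \<eta>" and \<epsilon>0: "\<epsilon> \<le> \<epsilon>0" "\<epsilon>0 < 1 / 2"
  defines "c \<equiv> 1 - 2 * \<epsilon>0"
  defines "\<theta> \<equiv> \<eta> * c / 4"
  assumes bias: "sqrt 2 / t + \<epsilon> * t * cmod (scale_bias t) \<le> \<theta> / 2"
  defines "b \<equiv> exp (A * t\<^sup>2) * (6 + 2 * A + 10 * A\<^sup>2 * t\<^sup>2) / n * (4 / c\<^sup>2 + 4 / \<theta>\<^sup>2)"
  shows "emeasure (sample_measure n u0 \<sigma>0 \<epsilon> H)
      {x \<in> space (sample_measure n u0 \<sigma>0 \<epsilon> H). \<bar>u0_est d n t x - u0\<bar> > \<eta>} \<le> ennreal b"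
    and "emeasure (sample_measure n u0 \<sigma>0 \<epsilon> H)
      {x \<in> space (sample_measure n u0 \<sigma>0 \<epsilon> H). \<bar>sigma0_sq_est d n t x - \<sigma>0\<^sup>2\<bar> > \<eta>} \<le> ennreal b"
proof -
  let ?P = "sample_measure n u0 \<sigma>0 \<epsilon> H"
  have t0: "0 < t" using t by simp
  have c: "0 < c" using \<epsilon>0 by (simp add: c_def)
  have \<theta>: "0 < \<theta>" using c \<eta> by (simp add: \<theta>_def)
  define fW where "fW = affine_exp 0 1 t"
  define fZ where "fZ = affine_exp omega (- \<i> * of_real (t * \<sigma>0\<^sup>2)) t"
  define B where "B = exp (A * t\<^sup>2) * (6 + 2 * A + 10 * A\<^sup>2 * t\<^sup>2)"
  have B0: "0 \<le> B" using A_nonneg by (simp add: B_def)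
  have At: "0 \<le> A\<^sup>2 * t\<^sup>2" by simp
  have mW [measurable]: "fW \<in> borel_measurable borel" and mZ [measurable]: "fZ \<in> borel_measurable borel"
    by (simp_all add: fW_def fZ_def)
  have fWm: "fW \<in> borel_measurable X_law" and fZm: "fZ \<in> borel_measurable X_law"
    by simp_all
  have B_W: "(\<integral>\<^sup>+x. ennreal ((cmod (fW x))\<^sup>2) \<partial>X_law) \<le> ennreal B"
    unfolding fW_def
  proof (rule order_trans[OF second_moment_affine_exp[OF t] ennreal_leI])
    show "exp (A * t\<^sup>2) * ((cmod 0)\<^sup>2 * (4 + 2 * A + 8 * A\<^sup>2 * t\<^sup>2) + 2 * (cmod 1)\<^sup>2) \<le> B"
    proof -
      have "(cmod 0)\<^sup>2 * (4 + 2 * A + 8 * A\<^sup>2 * t\<^sup>2) + 2 * (cmod 1)\<^sup>2 \<le> 6 + 2 * A + 10 * A\<^sup>2 * t\<^sup>2"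
        using A_nonneg At by simp
      then show ?thesis unfolding B_def by (rule mult_left_mono) simp
    qed
  qed
  have B_Z: "(\<integral>\<^sup>+x. ennreal ((cmod (fZ x))\<^sup>2) \<partial>X_law) \<le> ennreal B"
    unfolding fZ_def
  proof (rule order_trans[OF second_moment_affine_exp[OF t] ennreal_leI])
    have "(t * \<sigma>0\<^sup>2)\<^sup>2 \<le> (t * A)\<^sup>2"
      using t0 sigma0 by (intro power_mono mult_left_mono) auto
    then have "(cmod (- \<i> * of_real (t * \<sigma>0\<^sup>2)))\<^sup>2 \<le> A\<^sup>2 * t\<^sup>2"
      unfolding norm_mult norm_minus_cancel norm_of_real power2_abs
      by (simp add: power_mult_distrib mult.commute)
    then have "1 * (4 + 2 * A + 8 * A\<^sup>2 * t\<^sup>2) + 2 * (cmod (- \<i> * of_real (t * \<sigma>0\<^sup>2)))\<^sup>2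
      \<le> 6 + 2 * A + 10 * A\<^sup>2 * t\<^sup>2" by simp
    then show "exp (A * t\<^sup>2) * ((cmod omega)\<^sup>2 * (4 + 2 * A + 8 * A\<^sup>2 * t\<^sup>2) + 2 * (cmod (- \<i> * of_real (t * \<sigma>0\<^sup>2)))\<^sup>2) \<le> B"
      unfolding B_def norm_omega power_one by (rule mult_left_mono) simp
  qed
  have c2: "0 < c / 2" and \<theta>2: "0 < \<theta> / 2" using c \<theta> by auto
  note chW = prob_space.integrable_if_second_moment_le(2)[OF prob_space_X_law fWm B_W]
    iid_mean_Chebyshev[OF prob_space_X_law n c2 B0 fWm B_W]
  note chZ = prob_space.integrable_if_second_moment_le(2)[OF prob_space_X_law fZm B_Z]
    iid_mean_Chebyshev[OF prob_space_X_law n \<theta>2 B0 fZm B_Z]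
  define EW where "EW = integral\<^sup>L X_law fW"
  define EZ where "EZ = integral\<^sup>L X_law fZ"
  have EW: "c \<le> cmod EW"
    using norm_mean_denominator_ge[OF _ chW(1)[unfolded fW_def]] t0 \<epsilon>0 unfolding EW_def fW_def c_def by simp
  have EZ: "cmod EZ \<le> \<theta> / 2"
    unfolding EZ_def fZ_def by (rule order_trans[OF norm_mean_numerator_le[OF t0 chZ(1)[unfolded fZ_def]] bias])
  define Wb where "Wb x = (\<Sum>j=1..n. fW (x j)) / of_nat n" for x
  define Zb where "Zb x = (\<Sum>j=1..n. fZ (x j)) / of_nat n" for x
  define GW where "GW = {x \<in> space ?P. c / 2 \<le> cmod (Wb x - EW)}"
  define GZ where "GZ = {x \<in> space ?P. \<theta> / 2 \<le> cmod (Zb x - EZ)}"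
  have GW: "emeasure ?P GW \<le> ennreal (B / (n * (c / 2)\<^sup>2))"
    using chW(2) unfolding GW_def Wb_def EW_def sample_measure_def by simp
  have GZ: "emeasure ?P GZ \<le> ennreal (B / (n * (\<theta> / 2)\<^sup>2))"
    using chZ(2) unfolding GZ_def Zb_def EZ_def sample_measure_def by simp
  have GWs [measurable]: "GW \<in> sets ?P" and GZs [measurable]: "GZ \<in> sets ?P"
    unfolding GW_def GZ_def Wb_def Zb_def sample_measure_def by measurable
  have "emeasure ?P (GW \<union> GZ) \<le> emeasure ?P GW + emeasure ?P GZ"
    by (rule emeasure_subadditive[OF GWs GZs])
  also have "\<dots> \<le> ennreal (B / (n * (c / 2)\<^sup>2)) + ennreal (B / (n * (\<theta> / 2)\<^sup>2))"
    by (rule add_mono[OF GW GZ])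
  also have "\<dots> = ennreal (B / (n * (c / 2)\<^sup>2) + B / (n * (\<theta> / 2)\<^sup>2))"
    using B0 by simp
  also have "B / (n * (c / 2)\<^sup>2) + B / (n * (\<theta> / 2)\<^sup>2) = b"
    using n c \<theta> unfolding b_def B_def[symmetric] by (simp add: power_divide distrib_left)
  finally have bad: "emeasure ?P (GW \<union> GZ) \<le> ennreal b" .
  have good: "Wb x \<noteq> 0 \<and> sqrt 2 * cmod (Zb x / Wb x) \<le> \<eta>" if "x \<in> space ?P" "x \<notin> GW \<union> GZ" for x
  proof -
    have "cmod (Wb x - EW) < c / 2" "cmod (Zb x - EZ) < \<theta> / 2"
      using that by (auto simp: GW_def GZ_def)
    then have W: "c / 2 < cmod (Wb x)" and Z: "cmod (Zb x) < \<theta>"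
      using EW EZ norm_triangle_ineq2[of EW "Wb x"] norm_triangle_ineq2[of "Zb x" EZ]
      by (auto simp: norm_minus_commute)
    have "cmod (Zb x / Wb x) \<le> \<theta> / (c / 2)"
      unfolding norm_divide using W Z c \<theta> by (intro frac_le) auto
    also have "\<dots> = \<eta> / 2" using c by (simp add: \<theta>_def)
    finally have "sqrt 2 * cmod (Zb x / Wb x) \<le> 2 * (\<eta> / 2)"
      using sqrt2_less_2 by (intro mult_mono) auto
    then show ?thesis using W c by auto
  qed
  have err: "\<bar>u0_est d n t x - u0\<bar> \<le> sqrt 2 * cmod (Zb x / Wb x)"
      "\<bar>sigma0_sq_est d n t x - \<sigma>0\<^sup>2\<bar> \<le> sqrt 2 * cmod (Zb x / Wb x)" if W: "Wb x \<noteq> 0" for x d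
  proof -
    have Wx: "Wb x = (\<Sum>j=1..n. exp (omega * of_real (t * (x j - u0)))) / of_nat n"
      by (simp add: Wb_def fW_def affine_exp_def)
    have Zx: "Zb x = (\<Sum>j=1..n. (omega * of_real (x j - u0) + (- \<i> * of_real (t * \<sigma>0\<^sup>2))) * exp (omega * of_real (t * (x j - u0)))) / of_nat n"
      by (simp only: Zb_def fZ_def affine_exp_def)
    note E = estimator_errors[OF t0 n, of x u0 d \<sigma>0, folded Wx, folded Zx, OF W]
    show "\<bar>u0_est d n t x - u0\<bar> \<le> sqrt 2 * cmod (Zb x / Wb x)"
      unfolding E by (simp add: abs_mult abs_Re_le_cmod)
    have "\<bar>Re (omega * (Zb x / Wb x))\<bar> \<le> cmod (Zb x / Wb x)"
      using abs_Re_le_cmod[of "omega * (Zb x / Wb x)"] by (simp only: norm_mult norm_omega mult_1)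
    moreover have "sqrt 2 / t \<le> sqrt 2" using t by (simp add: divide_le_eq)
    ultimately show "\<bar>sigma0_sq_est d n t x - \<sigma>0\<^sup>2\<bar> \<le> sqrt 2 * cmod (Zb x / Wb x)"
      unfolding E abs_mult using t0 by (intro mult_mono) auto
  qed
  have sub: "{x \<in> space ?P. \<bar>u0_est d n t x - u0\<bar> > \<eta>} \<subseteq> GW \<union> GZ"
    "{x \<in> space ?P. \<bar>sigma0_sq_est d n t x - \<sigma>0\<^sup>2\<bar> > \<eta>} \<subseteq> GW \<union> GZ"
    using good err by (force dest: leD order_trans)+
  show "emeasure ?P {x \<in> space ?P. \<bar>u0_est d n t x - u0\<bar> > \<eta>} \<le> ennreal b"
    by (rule order_trans[OF emeasure_mono[OF sub(1)] bad]) measurable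
  show "emeasure ?P {x \<in> space ?P. \<bar>sigma0_sq_est d n t x - \<sigma>0\<^sup>2\<bar> > \<eta>} \<le> ennreal b"
    by (rule order_trans[OF emeasure_mono[OF sub(2)] bad]) measurable
qed

end

text \<open>
  One summand for each of the three alternatives defining the class: weak contamination uses only the
  trivial bound on the scale bias, separated locations its exponential decay, and smooth
  mixing the decay of the conditional Fourier transform.
\<close>

lemma scale_bias_Lambda_star_le:
  assumes L: "(u0, \<sigma>0, \<epsilon>, H) \<in> Lambda_star \<epsilon>0 A t a d \<alpha> C" and \<epsilon>0: "\<epsilon>0 \<le> 1"
    and t: "0 < t" and \<alpha>: "0 \<le> \<alpha>" and C: "0 \<le> C"
  shows "\<epsilon> * t * cmod (normal_contamination.scale_bias u0 \<sigma>0 H t)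
    \<le> A * \<bar>a\<bar> + A * (t * exp (- (t * d / sqrt 2))) + 2 * C / t"
proof -
  have "(u0, \<sigma>0, \<epsilon>, H) \<in> Lambda \<epsilon>0 A" using L by (simp add: Lambda_star_def)
  then interpret normal_contamination u0 \<sigma>0 \<epsilon> A H
    by (rule normal_contamination_Lambda) (rule \<epsilon>0)
  have nn: "0 \<le> A * \<bar>a\<bar>" "0 \<le> A * (t * exp (- (t * d / sqrt 2)))" "0 \<le> 2 * C / t"
    using A_nonneg t C by auto
  have et: "\<epsilon> * t * cmod (scale_bias t) \<le> t * cmod (scale_bias t)"
    using eps t by (intro mult_right_mono mult_left_le_one_le) auto
  consider "\<epsilon> * t \<le> a" | "measure H {(u, \<sigma>). u0 + d < u} = 1" | "FT_bounds \<alpha> C u0 \<sigma>0 H"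
    using L by (auto simp: Lambda_star_def)
  then show ?thesis
  proof cases
    case 1
    have "AE z in H. 0 \<le> fst z - u0" using AE_H by auto
    then have "cmod (scale_bias t) \<le> A" using norm_scale_bias_le[of t 0] t by simp
    then have "\<epsilon> * t * cmod (scale_bias t) \<le> \<bar>a\<bar> * A"
      using 1 by (intro mult_mono) auto
    then show ?thesis using nn by (simp add: mult.commute)
  next
    case 2
    have "AE z in H. d \<le> fst z - u0"
      using H.AE_prob_1[OF 2] by (auto elim!: eventually_mono)
    then have "t * cmod (scale_bias t) \<le> t * (A * exp (- (t * d / sqrt 2)))"
      using t by (intro mult_left_mono norm_scale_bias_le) auto
    then show ?thesis using nn et by (simp add: mult.left_commute)
  next
    case 3
    have "cmod (scale_bias t) \<le> 2 * (C * (1 + t\<^sup>2) powr (- (\<alpha> + 1)))"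
      using 3 t by (intro norm_scale_bias_le_FT) auto
    also have "\<dots> \<le> 2 * (C * (1 / t\<^sup>2))"
    proof -
      have "(1 + t\<^sup>2) powr (- (\<alpha> + 1)) \<le> (1 + t\<^sup>2) powr (- 1)"
        using \<alpha> by (intro powr_mono) auto
      also have "\<dots> = 1 / (1 + t\<^sup>2)" by (simp add: powr_minus_divide)
      also have "\<dots> \<le> 1 / t\<^sup>2" using t by (intro frac_le) auto
      finally show ?thesis using C by (intro mult_left_mono) auto
    qed
    finally have "t * cmod (scale_bias t) \<le> t * (2 * (C * (1 / t\<^sup>2)))"
      using t by (intro mult_left_mono) auto
    also have "\<dots> = 2 * C / t" using t by (simp add: power2_eq_square)
    finally show ?thesis using nn et by linarith
  qed
qed

lemma t_seq_at_top: "0 < \<gamma> \<Longrightarrow> filterlim (t_seq \<gamma>) at_top at_top"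
  unfolding t_seq_def by real_asymp

text \<open>
  The lower limit makes the exponent at least \<open>(c0 / 2 + 1) * ln t\<close> eventually; the surplus over \<open>ln t\<close>
  outweighs the factor \<open>t\<close>.
\<close>

lemma separation_term_tendsto_0:
  assumes \<gamma>: "0 < \<gamma>" and c0: "0 < c0"
    and lim: "liminf (\<lambda>n. ereal (\<delta> n * t_seq \<gamma> n / (sqrt 2 * ln (t_seq \<gamma> n)))) \<ge> ereal (c0 + 1)"
  shows "(\<lambda>n. t_seq \<gamma> n * exp (- (t_seq \<gamma> n * \<delta> n / sqrt 2))) \<longlonglongrightarrow> 0"
proof (rule tendsto_sandwich)
  have "ereal (c0 / 2 + 1) < liminf (\<lambda>n. ereal (\<delta> n * t_seq \<gamma> n / (sqrt 2 * ln (t_seq \<gamma> n))))"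
    using c0 by (intro less_le_trans[OF _ lim]) simp
  then have ev: "\<forall>\<^sub>F n in sequentially. c0 / 2 + 1 < \<delta> n * t_seq \<gamma> n / (sqrt 2 * ln (t_seq \<gamma> n))"
    by (auto dest: less_LiminfD)
  have t1: "\<forall>\<^sub>F n in sequentially. 1 < t_seq \<gamma> n"
    using t_seq_at_top[OF \<gamma>] by (auto simp: filterlim_at_top_dense)
  show "\<forall>\<^sub>F n in sequentially. 0 \<le> t_seq \<gamma> n * exp (- (t_seq \<gamma> n * \<delta> n / sqrt 2))"
    using t1 by eventually_elim auto
  show "\<forall>\<^sub>F n in sequentially. t_seq \<gamma> n * exp (- (t_seq \<gamma> n * \<delta> n / sqrt 2)) \<le> t_seq \<gamma> n powr (- (c0 / 2))"
    using ev t1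
  proof eventually_elim
    case (elim n)
    let ?t = "t_seq \<gamma> n"
    have l: "0 < ln ?t" using elim by simp
    have "(c0 / 2 + 1) * (sqrt 2 * ln ?t) < \<delta> n * ?t"
      using elim(1) l by (simp add: pos_less_divide_eq)
    then have "(c0 / 2 + 1) * ln ?t \<le> ?t * \<delta> n / sqrt 2"
      by (simp add: field_simps)
    then have "exp (- (?t * \<delta> n / sqrt 2)) \<le> exp (- ((c0 / 2 + 1) * ln ?t))" by simp
    then have "?t * exp (- (?t * \<delta> n / sqrt 2)) \<le> exp (ln ?t) * exp (- ((c0 / 2 + 1) * ln ?t))"
      using elim by simp
    also have "\<dots> = ?t powr (- (c0 / 2))"
      using elim unfolding powr_def exp_add[symmetric] by (simp add: algebra_simps)
    finally show ?case .
  qed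
  have "((\<lambda>x::real. x powr (- (c0 / 2))) \<longlongrightarrow> 0) at_top" using c0 by real_asymp
  then show "(\<lambda>n. t_seq \<gamma> n powr (- (c0 / 2))) \<longlonglongrightarrow> 0"
    by (rule filterlim_compose) (rule t_seq_at_top[OF \<gamma>])
qed simp

lemma variance_term_tendsto_0:
  assumes "0 < \<gamma>" "0 < A" "\<gamma> < 1 / A"
  shows "(\<lambda>n. exp (A * (t_seq \<gamma> n)\<^sup>2) * (6 + 2 * A + 10 * A\<^sup>2 * (t_seq \<gamma> n)\<^sup>2) / real n * K) \<longlonglongrightarrow> 0"
proof -
  define \<rho> where "\<rho> = 1 - A * \<gamma>"
  have \<rho>: "0 < \<rho>" using assms by (simp add: \<rho>_def field_simps)
  have "(\<lambda>n. real n powr (- \<rho>) * (6 + 2 * A + 10 * A\<^sup>2 * (\<gamma> * ln (real n))) * K) \<longlonglongrightarrow> 0"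
    using \<rho> by real_asymp
  moreover have "\<forall>\<^sub>F n in sequentially. real n powr (- \<rho>) * (6 + 2 * A + 10 * A\<^sup>2 * (\<gamma> * ln (real n))) * K
    = exp (A * (t_seq \<gamma> n)\<^sup>2) * (6 + 2 * A + 10 * A\<^sup>2 * (t_seq \<gamma> n)\<^sup>2) / real n * K"
    using eventually_ge_at_top[of 1]
  proof eventually_elim
    case (elim n)
    then have t2: "(t_seq \<gamma> n)\<^sup>2 = \<gamma> * ln (real n)" using assms by (simp add: t_seq_def)
    have "exp (A * (\<gamma> * ln (real n))) / real n = exp (A * (\<gamma> * ln (real n)) - ln (real n))"
      using elim by (simp add: exp_diff)
    also have "\<dots> = real n powr (- \<rho>)"
      using elim by (simp add: powr_def \<rho>_def algebra_simps)
    finally have "real n powr (- \<rho>) = exp (A * (\<gamma> * ln (real n))) / real n" ..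
    then show ?case unfolding t2 by simp
  qed
  ultimately show ?thesis by (rule Lim_transform_eventually)
qed

theorem theorem2p1:
  fixes \<epsilon>0 A \<gamma> c0 \<alpha> C :: real
    and a \<delta> :: "nat \<Rightarrow> real"
    and d1 d2 :: "nat \<Rightarrow> (nat \<Rightarrow> real) \<Rightarrow> real"
  assumes "0 < \<epsilon>0" "\<epsilon>0 < 1 / 2"
    and "0 < A"
    and "0 < \<gamma>" "\<gamma> < 1 / A"
    and "a \<longlonglongrightarrow> 0"
    and "\<And>n. 0 < \<delta> n"
    and "0 < c0"
    and "liminf (\<lambda>n. ereal (\<delta> n * t_seq \<gamma> n / (sqrt 2 * ln (t_seq \<gamma> n)))) \<ge> ereal (c0 + 1)"
    and "0 < \<alpha>" "0 < C"
    and "\<And>n. d1 n \<in> borel_measurable (\<Pi>\<^sub>M j\<in>{1..n}. borel)"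
    and "\<And>n. d2 n \<in> borel_measurable (\<Pi>\<^sub>M j\<in>{1..n}. borel)"
  shows "\<forall>\<eta>>0.
      (\<lambda>n. SUP (u0, \<sigma>0, \<epsilon>, H) \<in> Lambda_star \<epsilon>0 A (t_seq \<gamma> n) (a n) (\<delta> n) \<alpha> C.
         emeasure (sample_measure n u0 \<sigma>0 \<epsilon> H)
           {x \<in> space (sample_measure n u0 \<sigma>0 \<epsilon> H).
              \<bar>u0_est (d1 n) n (t_seq \<gamma> n) x - u0\<bar> > \<eta>}) \<longlonglongrightarrow> 0
    \<and> (\<lambda>n. SUP (u0, \<sigma>0, \<epsilon>, H) \<in> Lambda_star \<epsilon>0 A (t_seq \<gamma> n) (a n) (\<delta> n) \<alpha> C.
         emeasure (sample_measure n u0 \<sigma>0 \<epsilon> H)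
           {x \<in> space (sample_measure n u0 \<sigma>0 \<epsilon> H).
              \<bar>sigma0_sq_est (d2 n) n (t_seq \<gamma> n) x - \<sigma>0\<^sup>2\<bar> > \<eta>}) \<longlonglongrightarrow> 0"
proof (intro allI impI)
  fix \<eta> :: real assume \<eta>: "0 < \<eta>"
  define c where "c = 1 - 2 * \<epsilon>0"
  define \<theta> where "\<theta> = \<eta> * c / 4"
  have c: "0 < c" using assms(2) by (simp add: c_def)
  have \<theta>: "0 < \<theta>" using c \<eta> by (simp add: \<theta>_def)
  let ?t = "t_seq \<gamma>"
  (* e n bounds the mean of the numerator, b n the probability of a deviation; neither depends on the member of the class. *)
  define e where "e n = sqrt 2 / ?t n + (A * \<bar>a n\<bar> + A * (?t n * exp (- (?t n * \<delta> n / sqrt 2))) + 2 * C / ?t n)" for n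
  define b where "b n = exp (A * (?t n)\<^sup>2) * (6 + 2 * A + 10 * A\<^sup>2 * (?t n)\<^sup>2) / real n * (4 / c\<^sup>2 + 4 / \<theta>\<^sup>2)" for n
  have tt: "filterlim ?t at_top sequentially" by (rule t_seq_at_top[OF assms(4)])
  have inv: "(\<lambda>n. k / ?t n) \<longlonglongrightarrow> 0" for k :: real
    by (rule tendsto_divide_0[OF tendsto_const]) (rule filterlim_at_top_imp_at_infinity[OF tt])
  have "e \<longlonglongrightarrow> 0 + (A * \<bar>0\<bar> + A * 0 + 0)"
    unfolding e_def [abs_def]
    by (intro tendsto_intros inv assms(6) separation_term_tendsto_0[OF assms(4) assms(8) assms(9)])
  then have "\<forall>\<^sub>F n in sequentially. e n < \<theta> / 2"
    using \<theta> by (intro order_tendstoD(2)) auto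
  moreover have "\<forall>\<^sub>F n in sequentially. 1 \<le> ?t n"
    using tt by (simp add: filterlim_at_top)
  ultimately have ev: "\<forall>\<^sub>F n in sequentially. 0 < n \<and> 1 \<le> ?t n \<and> e n \<le> \<theta> / 2"
    using eventually_gt_at_top[of 0] by eventually_elim auto
  have dev: "emeasure (sample_measure n u0 \<sigma>0 \<epsilon> H) {x \<in> space (sample_measure n u0 \<sigma>0 \<epsilon> H).
         \<bar>u0_est d n (?t n) x - u0\<bar> > \<eta>} \<le> ennreal (b n) \<and>
      emeasure (sample_measure n u0 \<sigma>0 \<epsilon> H) {x \<in> space (sample_measure n u0 \<sigma>0 \<epsilon> H).
         \<bar>sigma0_sq_est d n (?t n) x - \<sigma>0\<^sup>2\<bar> > \<eta>} \<le> ennreal (b n)"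
    if n: "0 < n \<and> 1 \<le> ?t n \<and> e n \<le> \<theta> / 2"
      and L: "(u0, \<sigma>0, \<epsilon>, H) \<in> Lambda_star \<epsilon>0 A (?t n) (a n) (\<delta> n) \<alpha> C" for n u0 \<sigma>0 \<epsilon> H d
  proof -
    have L': "(u0, \<sigma>0, \<epsilon>, H) \<in> Lambda \<epsilon>0 A" using L by (simp add: Lambda_star_def)
    then interpret normal_contamination u0 \<sigma>0 \<epsilon> A H
      by (rule normal_contamination_Lambda) (use assms(2) in simp)
    have "\<epsilon> \<le> \<epsilon>0" using L' by (simp add: Lambda_def)
    moreover have "sqrt 2 / ?t n + \<epsilon> * ?t n * cmod (scale_bias (?t n)) \<le> \<theta> / 2"
      using scale_bias_Lambda_star_le[OF L] n assms(2,10,11) by (simp add: e_def)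
    ultimately show ?thesis
      using estimator_deviation[of n "?t n" \<eta> \<epsilon>0 d] n \<eta> assms(2)
      unfolding b_def \<theta>_def c_def by blast
  qed
  have b0: "(\<lambda>n. ennreal (b n)) \<longlonglongrightarrow> 0"
    using tendsto_ennrealI[OF variance_term_tendsto_0[OF assms(4,3,5)]] unfolding b_def [abs_def] by simp
  show "(\<lambda>n. SUP (u0, \<sigma>0, \<epsilon>, H) \<in> Lambda_star \<epsilon>0 A (t_seq \<gamma> n) (a n) (\<delta> n) \<alpha> C.
         emeasure (sample_measure n u0 \<sigma>0 \<epsilon> H)
           {x \<in> space (sample_measure n u0 \<sigma>0 \<epsilon> H).
              \<bar>u0_est (d1 n) n (t_seq \<gamma> n) x - u0\<bar> > \<eta>}) \<longlonglongrightarrow> 0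
    \<and> (\<lambda>n. SUP (u0, \<sigma>0, \<epsilon>, H) \<in> Lambda_star \<epsilon>0 A (t_seq \<gamma> n) (a n) (\<delta> n) \<alpha> C.
         emeasure (sample_measure n u0 \<sigma>0 \<epsilon> H)
           {x \<in> space (sample_measure n u0 \<sigma>0 \<epsilon> H).
              \<bar>sigma0_sq_est (d2 n) n (t_seq \<gamma> n) x - \<sigma>0\<^sup>2\<bar> > \<eta>}) \<longlonglongrightarrow> 0"
  proof (intro conjI)
    show "(\<lambda>n. SUP (u0, \<sigma>0, \<epsilon>, H) \<in> Lambda_star \<epsilon>0 A (t_seq \<gamma> n) (a n) (\<delta> n) \<alpha> C.
         emeasure (sample_measure n u0 \<sigma>0 \<epsilon> H)
           {x \<in> space (sample_measure n u0 \<sigma>0 \<epsilon> H).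
              \<bar>u0_est (d1 n) n (t_seq \<gamma> n) x - u0\<bar> > \<eta>}) \<longlonglongrightarrow> 0"
    proof (rule tendsto_sandwich[OF _ _ tendsto_const b0])
      show "\<forall>\<^sub>F n in sequentially. (SUP (u0, \<sigma>0, \<epsilon>, H) \<in> Lambda_star \<epsilon>0 A (t_seq \<gamma> n) (a n) (\<delta> n) \<alpha> C.
         emeasure (sample_measure n u0 \<sigma>0 \<epsilon> H)
           {x \<in> space (sample_measure n u0 \<sigma>0 \<epsilon> H).
              \<bar>u0_est (d1 n) n (t_seq \<gamma> n) x - u0\<bar> > \<eta>}) \<le> ennreal (b n)"
        using ev
      proof eventually_elim
        case (elim n)
        show ?case
          by (rule SUP_least, clarify, rule conjunct1[OF dev[OF elim]])
      qed
    qed simp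
    show "(\<lambda>n. SUP (u0, \<sigma>0, \<epsilon>, H) \<in> Lambda_star \<epsilon>0 A (t_seq \<gamma> n) (a n) (\<delta> n) \<alpha> C.
         emeasure (sample_measure n u0 \<sigma>0 \<epsilon> H)
           {x \<in> space (sample_measure n u0 \<sigma>0 \<epsilon> H).
              \<bar>sigma0_sq_est (d2 n) n (t_seq \<gamma> n) x - \<sigma>0\<^sup>2\<bar> > \<eta>}) \<longlonglongrightarrow> 0"
    proof (rule tendsto_sandwich[OF _ _ tendsto_const b0])
      show "\<forall>\<^sub>F n in sequentially. (SUP (u0, \<sigma>0, \<epsilon>, H) \<in> Lambda_star \<epsilon>0 A (t_seq \<gamma> n) (a n) (\<delta> n) \<alpha> C.
         emeasure (sample_measure n u0 \<sigma>0 \<epsilon> H)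
           {x \<in> space (sample_measure n u0 \<sigma>0 \<epsilon> H).
              \<bar>sigma0_sq_est (d2 n) n (t_seq \<gamma> n) x - \<sigma>0\<^sup>2\<bar> > \<eta>}) \<le> ennreal (b n)"
        using ev
      proof eventually_elim
        case (elim n)
        show ?case
          by (rule SUP_least, clarify, rule conjunct2[OF dev[OF elim]])
      qed
    qed simp
  qed
qed

end
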